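(* Let $F$ be a nonreal field with $\operatorname{char}(F)\neq 2$ and $u(F)=4$. Then every set of three quaternion algebras over $F$ is linked.
   Context: A field is nonreal if $-1$ is a sum of squares in it. $u(F)$ is the supremum of the dimensions of nonsingular anisotropic quadratic forms over $F$ of finite order in the Witt group of $F$ (for $F$ nonreal, every class has finite order). A set of quaternion algebras over $F$ is linked if their norm forms (which are $2$-fold Pfister forms) have a common $1$-fold Pfister factor; in terms of algebras, this is the condition that they share a common maximal subfield, i.e. a common quadratic field extension of $F$ contained in each of them. *)

theory Defs
  imports
    "Jordan_Normal_Form.VS_Connect"
    "HOL-Library.Extended_Nat"
begin

section \<open>Quadratic forms\<close>

text \<open>
  The base field \<open>F\<close> is a type \<open>'a\<close> of class \<open>field\<close>; \<open>class_ring\<close> is \<open>F\<close> as a ring record.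
  A quadratic space is a vector space record \<open>V\<close> over \<open>F\<close> together with a map \<open>q\<close> from its
  carrier to \<open>F\<close>; values of \<open>q\<close> outside the carrier are irrelevant.
\<close>

definition polar_form :: "('a::field, 'v, 'm) module_scheme \<Rightarrow> ('v \<Rightarrow> 'a) \<Rightarrow> 'v \<Rightarrow> 'v \<Rightarrow> 'a" where
  "polar_form V q x y = q (x \<oplus>\<^bsub>V\<^esub> y) - q x - q y"

text \<open>The polar form is symmetric, so linearity in the first argument is bilinearity.\<close>

definition quadratic_form :: "('a::field, 'v, 'm) module_scheme \<Rightarrow> ('v \<Rightarrow> 'a) \<Rightarrow> bool" where
  "quadratic_form V q \<longleftrightarrow>
     vectorspace class_ring V \<and>
     (\<forall>c. \<forall>x\<in>carrier V. q (c \<odot>\<^bsub>V\<^esub> x) = c^2 * q x) \<and>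
     (\<forall>x\<in>carrier V. \<forall>y\<in>carrier V. \<forall>z\<in>carrier V.
        polar_form V q (x \<oplus>\<^bsub>V\<^esub> y) z = polar_form V q x z + polar_form V q y z) \<and>
     (\<forall>c. \<forall>x\<in>carrier V. \<forall>y\<in>carrier V.
        polar_form V q (c \<odot>\<^bsub>V\<^esub> x) y = c * polar_form V q x y)"

definition nonsingular :: "('a::field, 'v, 'm) module_scheme \<Rightarrow> ('v \<Rightarrow> 'a) \<Rightarrow> bool" where
  "nonsingular V q \<longleftrightarrow>
     (\<forall>x\<in>carrier V. (\<forall>y\<in>carrier V. polar_form V q x y = 0) \<longrightarrow> x = \<zero>\<^bsub>V\<^esub>)"

definition anisotropic :: "('a::field, 'v, 'm) module_scheme \<Rightarrow> ('v \<Rightarrow> 'a) \<Rightarrow> bool" where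
  "anisotropic V q \<longleftrightarrow> (\<forall>x\<in>carrier V. q x = 0 \<longrightarrow> x = \<zero>\<^bsub>V\<^esub>)"

definition isometric ::
  "('a::field, 'v, 'm) module_scheme \<Rightarrow> ('v \<Rightarrow> 'a) \<Rightarrow> ('a, 'w, 'n) module_scheme \<Rightarrow> ('w \<Rightarrow> 'a) \<Rightarrow> bool"
where
  "isometric V q W r \<longleftrightarrow>
     (\<exists>f. f \<in> LinearCombinations.module_hom class_ring V W \<and> bij_betw f (carrier V) (carrier W) \<and>
          (\<forall>x\<in>carrier V. r (f x) = q x))"


subsection \<open>Forms on coordinate spaces, Witt equivalence and the u-invariant\<close>

abbreviation coord_space :: "nat \<Rightarrow> ('a::field, 'a vec) module" where
  "coord_space n \<equiv> module_vec TYPE('a) n"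

text \<open>
  The orthogonal sum of a form \<open>q\<close> on \<open>F\<^sup>n\<close> and a form \<open>r\<close> on \<open>F\<^sup>m\<close>, as a form on \<open>F\<^sup>n\<^sup>+\<^sup>m\<close>.
\<close>

definition orth_sum :: "nat \<Rightarrow> ('a::field vec \<Rightarrow> 'a) \<Rightarrow> nat \<Rightarrow> ('a vec \<Rightarrow> 'a) \<Rightarrow> 'a vec \<Rightarrow> 'a" where
  "orth_sum n q m r v = q (vec_first v n) + r (vec_last v m)"

text \<open>The orthogonal sum of \<open>k\<close> copies of a form \<open>q\<close> on \<open>F\<^sup>n\<close>, as a form on \<open>F\<^sup>k\<^sup>n\<close>.\<close>

definition form_multiple :: "nat \<Rightarrow> nat \<Rightarrow> ('a::field vec \<Rightarrow> 'a) \<Rightarrow> 'a vec \<Rightarrow> 'a" where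
  "form_multiple k n q v = (\<Sum>i<k. q (vec n (\<lambda>j. v $ (i * n + j))))"

text \<open>The orthogonal sum of \<open>k\<close> hyperbolic planes \<open>xy\<close>, as a form on \<open>F\<^sup>2\<^sup>k\<close>.\<close>

definition hyperbolic_form :: "nat \<Rightarrow> 'a::field vec \<Rightarrow> 'a" where
  "hyperbolic_form k v = (\<Sum>i<k. v $ (2 * i) * v $ (2 * i + 1))"

definition witt_equivalent ::
  "nat \<Rightarrow> ('a::field vec \<Rightarrow> 'a) \<Rightarrow> nat \<Rightarrow> ('a vec \<Rightarrow> 'a) \<Rightarrow> bool" where
  "witt_equivalent n q m r \<longleftrightarrow>
     (\<exists>k l. isometric (coord_space (n + 2 * k)) (orth_sum n q (2 * k) (hyperbolic_form k))
                      (coord_space (m + 2 * l)) (orth_sum m r (2 * l) (hyperbolic_form l)))"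

text \<open>The class of \<open>q\<close> in the Witt group has finite order: some multiple \<open>kq\<close> with \<open>k > 0\<close> is Witt
  equivalent to the zero-dimensional form.\<close>

definition witt_finite_order :: "nat \<Rightarrow> ('a::field vec \<Rightarrow> 'a) \<Rightarrow> bool" where
  "witt_finite_order n q \<longleftrightarrow>
     (\<exists>k>0. witt_equivalent (k * n) (form_multiple k n q) 0 (\<lambda>_. 0))"

text \<open>Every finite-dimensional form is isometric to one on a coordinate space, so only those are
  needed in the supremum.\<close>

definition u_invariant :: "'a::field itself \<Rightarrow> enat" where
  "u_invariant _ = Sup {enat n | n. \<exists>q :: 'a vec \<Rightarrow> 'a.
     quadratic_form (coord_space n) q \<and> nonsingular (coord_space n) q \<and>
     anisotropic (coord_space n) q \<and> witt_finite_order n q}"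

definition nonreal :: "'a::field itself \<Rightarrow> bool" where
  "nonreal _ \<longleftrightarrow> (\<exists>xs :: 'a list. - 1 = (\<Sum>x\<leftarrow>xs. x^2))"


subsection \<open>Pfister forms\<close>

definition diagonal_form :: "'a::field list \<Rightarrow> 'a vec \<Rightarrow> 'a" where
  "diagonal_form as v = (\<Sum>i<length as. as ! i * (v $ i)^2)"

definition diag_tensor :: "'a::field list \<Rightarrow> 'a list \<Rightarrow> 'a list" where
  "diag_tensor as bs = [a * b. a \<leftarrow> as, b \<leftarrow> bs]"

text \<open>The diagonal coefficients of the 1-fold Pfister form of slot \<open>c\<close>. Sign convention: the form
  represents the norms from \<open>F(\<surd>c)\<close>.\<close>

definition pfister1 :: "'a::field \<Rightarrow> 'a list" where
  "pfister1 c = [1, - c]"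


section \<open>Quaternion algebras\<close>

locale assoc_algebra = vectorspace K A + ring A for K (structure) and A (structure) +
  assumes smult_mult_left:
    "\<lbrakk>c \<in> carrier K; x \<in> carrier A; y \<in> carrier A\<rbrakk> \<Longrightarrow> (c \<odot>\<^bsub>A\<^esub> x) \<otimes>\<^bsub>A\<^esub> y = c \<odot>\<^bsub>A\<^esub> (x \<otimes>\<^bsub>A\<^esub> y)"
  and smult_mult_right:
    "\<lbrakk>c \<in> carrier K; x \<in> carrier A; y \<in> carrier A\<rbrakk> \<Longrightarrow> x \<otimes>\<^bsub>A\<^esub> (c \<odot>\<^bsub>A\<^esub> y) = c \<odot>\<^bsub>A\<^esub> (x \<otimes>\<^bsub>A\<^esub> y)"

definition quaternion_comb ::
  "('a::field, 'q) module \<Rightarrow> 'q \<Rightarrow> 'q \<Rightarrow> 'a \<times> 'a \<times> 'a \<times> 'a \<Rightarrow> 'q" where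
  "quaternion_comb Q i j = (\<lambda>(w, x, y, z).
     w \<odot>\<^bsub>Q\<^esub> \<one>\<^bsub>Q\<^esub> \<oplus>\<^bsub>Q\<^esub> x \<odot>\<^bsub>Q\<^esub> i \<oplus>\<^bsub>Q\<^esub> y \<odot>\<^bsub>Q\<^esub> j \<oplus>\<^bsub>Q\<^esub> z \<odot>\<^bsub>Q\<^esub> (i \<otimes>\<^bsub>Q\<^esub> j))"

text \<open>
  \<open>Q\<close> is the quaternion algebra \<open>(a, b)\<close> over \<open>F\<close> with standard generators \<open>i\<close>, \<open>j\<close>: the elements
  \<open>1, i, j, ij\<close> form an \<open>F\<close>-basis. This is the presentation valid in characteristic different
  from 2.
\<close>

definition quaternion_generators ::
  "('a::field, 'q) module \<Rightarrow> 'a \<Rightarrow> 'a \<Rightarrow> 'q \<Rightarrow> 'q \<Rightarrow> bool" where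
  "quaternion_generators Q a b i j \<longleftrightarrow>
     a \<noteq> 0 \<and> b \<noteq> 0 \<and> i \<in> carrier Q \<and> j \<in> carrier Q \<and>
     i \<otimes>\<^bsub>Q\<^esub> i = a \<odot>\<^bsub>Q\<^esub> \<one>\<^bsub>Q\<^esub> \<and> j \<otimes>\<^bsub>Q\<^esub> j = b \<odot>\<^bsub>Q\<^esub> \<one>\<^bsub>Q\<^esub> \<and>
     j \<otimes>\<^bsub>Q\<^esub> i = \<ominus>\<^bsub>Q\<^esub> (i \<otimes>\<^bsub>Q\<^esub> j) \<and>
     bij_betw (quaternion_comb Q i j) UNIV (carrier Q)"

definition quaternion_algebra :: "('a::field, 'q) module \<Rightarrow> bool" where
  "quaternion_algebra Q \<longleftrightarrow>
     assoc_algebra class_ring Q \<and> (\<exists>a b i j. quaternion_generators Q a b i j)"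

text \<open>
  Pure quaternions are zero and the noncentral elements with central square; in characteristic
  different from 2 they are the \<open>xi + yj + zij\<close> for any choice of standard generators. Then every quaternion is uniquely \<open>c + p\<close> with \<open>c\<close> in \<open>F\<close> and \<open>p\<close> pure,
  its conjugate is \<open>c - p\<close>, and its norm is the scalar \<open>(c + p)(c - p)\<close>.
\<close>

definition quaternion_scalars :: "('a::field, 'q) module \<Rightarrow> 'q set" where
  "quaternion_scalars Q = {c \<odot>\<^bsub>Q\<^esub> \<one>\<^bsub>Q\<^esub> | c. True}"

definition pure_quaternions :: "('a::field, 'q) module \<Rightarrow> 'q set" where
  "pure_quaternions Q = {p \<in> carrier Q. p = \<zero>\<^bsub>Q\<^esub> \<or>
     (p \<notin> quaternion_scalars Q \<and> p \<otimes>\<^bsub>Q\<^esub> p \<in> quaternion_scalars Q)}"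

definition quaternion_conj :: "('a::field, 'q) module \<Rightarrow> 'q \<Rightarrow> 'q" where
  "quaternion_conj Q x = (THE y. \<exists>c. \<exists>p\<in>pure_quaternions Q.
     x = c \<odot>\<^bsub>Q\<^esub> \<one>\<^bsub>Q\<^esub> \<oplus>\<^bsub>Q\<^esub> p \<and> y = c \<odot>\<^bsub>Q\<^esub> \<one>\<^bsub>Q\<^esub> \<ominus>\<^bsub>Q\<^esub> p)"

definition norm_form :: "('a::field, 'q) module \<Rightarrow> 'q \<Rightarrow> 'a" where
  "norm_form Q x = (THE n. x \<otimes>\<^bsub>Q\<^esub> quaternion_conj Q x = n \<odot>\<^bsub>Q\<^esub> \<one>\<^bsub>Q\<^esub>)"

text \<open>
  A set of quaternion algebras is linked if a single 1-fold Pfister form \<open>\<langle>1, -c\<rangle>\<close> is a factor of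
  all the norm forms, the complementary factor being again a 1-fold Pfister form.
\<close>

definition linked :: "('a::field, 'q) module set \<Rightarrow> bool" where
  "linked S \<longleftrightarrow>
     (\<exists>c. c \<noteq> 0 \<and> (\<forall>Q\<in>S. \<exists>d. d \<noteq> 0 \<and>
        isometric Q (norm_form Q) (coord_space 4)
          (diagonal_form (diag_tensor (pfister1 c) (pfister1 d)))))"

end

theory Submission
  imports Defs "HOL-Library.Product_Plus"
begin

text \<open>
  Over a nonreal field all Witt classes have finite order, so \<open>u(F) = 4\<close> makes every quadratic form
  in five variables isotropic, and nothing else is needed. Three quaternion algebras are linked as
  soon as their pure parts have a common value \<open>f \<noteq> 0\<close>. Two of them can be written \<open>(m, u\<^sub>1)\<close> and
  \<open>(m, u\<^sub>2)\<close>, and the third one as \<open>(a, b)\<close> where \<open>a\<close> is also a slot of \<open>(m, u\<^sub>1 u\<^sub>2)\<close>; so \<open>(m, u\<^sub>1)\<close> and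
  \<open>(m, u\<^sub>2)\<close> become isomorphic over \<open>K = F(\<surd>a)\<close>. Let \<open>\<tau>\<close> be the canonical involution combined with
  the conjugation of \<open>K/F\<close>. Four-dimensional forms are universal, so both algebras contain over \<open>K\<close> an
  element \<open>g = p + \<surd>a l\<close>, with \<open>p\<close> pure over \<open>F\<close> and \<open>l\<close> in \<open>F\<close>, of norm \<open>- b\<close>. For every \<open>\<xi>\<close>, the element
  \<open>\<xi> g \<tau>(\<xi>)\<close> is again of the form \<open>p' + \<surd>a l'\<close>, and comparing norms gives \<open>p'\<^sup>2 = a l'\<^sup>2 + b N(T)\<close>, where
  \<open>T\<close> is the norm of \<open>\<xi>\<close>: a value of the pure part of \<open>(a, b)\<close>. For \<open>\<xi>\<close> of equal norm in both
  algebras, equality of the two values \<open>l'\<close> is a single quadratic equation, solvable in a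
  five-dimensional space.
\<close>

section \<open>Quaternions in coordinates\<close>

type_synonym 'a quat = "'a \<times> 'a \<times> 'a \<times> 'a"

fun quat_mult :: "'a::field \<Rightarrow> 'a \<Rightarrow> 'a quat \<Rightarrow> 'a quat \<Rightarrow> 'a quat" where
  "quat_mult a b (w, x, y, z) (w', x', y', z') =
     (w * w' + a * x * x' + b * y * y' - a * b * z * z',
      w * x' + x * w' - b * y * z' + b * z * y',
      w * y' + y * w' + a * x * z' - a * z * x',
      w * z' + z * w' + x * y' - y * x')"

text \<open>Twice this bilinear form is the polar form of the reduced norm.\<close>

fun quat_inner :: "'a::field \<Rightarrow> 'a \<Rightarrow> 'a quat \<Rightarrow> 'a quat \<Rightarrow> 'a" where
  "quat_inner a b (w, x, y, z) (w', x', y', z') = w * w' - a * x * x' - b * y * y' + a * b * z * z'"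

abbreviation quat_norm :: "'a::field \<Rightarrow> 'a \<Rightarrow> 'a quat \<Rightarrow> 'a" where
  "quat_norm a b p \<equiv> quat_inner a b p p"

fun quat_conj :: "'a::field quat \<Rightarrow> 'a quat" where
  "quat_conj (w, x, y, z) = (w, - x, - y, - z)"

fun quat_smult :: "'a::field \<Rightarrow> 'a quat \<Rightarrow> 'a quat" where
  "quat_smult c (w, x, y, z) = (c * w, c * x, c * y, c * z)"

section \<open>Multiplicativity and adjunction rules for the reduced norm\<close>

lemma quat_mult_assoc:
  "quat_mult a b (quat_mult a b p q) r = quat_mult a b p (quat_mult a b q r)"
  by (cases p; cases q; cases r) (simp add: algebra_simps)

lemma quat_conj_mult:
  "quat_conj (quat_mult a b p q) = quat_mult a b (quat_conj q) (quat_conj p)"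
  by (cases p; cases q) (simp add: algebra_simps)

lemma quat_conj_conj [simp]: "quat_conj (quat_conj p) = p"
  by (cases p) simp

lemma quat_norm_conj [simp]: "quat_norm a b (quat_conj p) = quat_norm a b p"
  by (cases p) simp

lemma quat_norm_mult: "quat_norm a b (quat_mult a b p q) = quat_norm a b p * quat_norm a b q"
  by (cases p; cases q) (simp add: algebra_simps)

lemma quat_inner_mult_left:
  "quat_inner a b (quat_mult a b p q) r = quat_inner a b q (quat_mult a b (quat_conj p) r)"
  by (cases p; cases q; cases r) (simp add: algebra_simps)

lemma quat_inner_mult_right:
  "quat_inner a b (quat_mult a b p q) r = quat_inner a b p (quat_mult a b r (quat_conj q))"
  by (cases p; cases q; cases r) (simp add: algebra_simps)

lemma quat_inner_commute: "quat_inner a b p q = quat_inner a b q p"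
  by (cases p; cases q) (simp add: algebra_simps)

lemma quat_inner_diff:
  "quat_inner a b (p - q) r = quat_inner a b p r - quat_inner a b q r"
  "quat_inner a b r (p - q) = quat_inner a b r p - quat_inner a b r q"
  by (cases p; cases q; cases r; simp add: algebra_simps)+

lemma quat_inner_add:
  "quat_inner a b (p + q) r = quat_inner a b p r + quat_inner a b q r"
  "quat_inner a b r (p + q) = quat_inner a b r p + quat_inner a b r q"
  by (cases p; cases q; cases r; simp add: algebra_simps)+

lemma quat_inner_smult:
  "quat_inner a b (quat_smult c p) r = c * quat_inner a b p r"
  "quat_inner a b r (quat_smult c p) = c * quat_inner a b r p"
  by (cases p; cases r; simp add: algebra_simps)+


text \<open>Write \<open>p\<close> for the pure quaternion. The formula follows from
  \<open>w\<^sup>* = 2 fst w - w\<close> and the quadratic equation of \<open>p w\<close>, whose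
  norm is the product of the norms of \<open>p\<close> and \<open>w\<close>.\<close>

lemma quat_inner_conjugate_pure:
  "quat_inner a b (0, x, y, z) (quat_mult a b (quat_mult a b w (0, x, y, z)) (quat_conj w)) =
     2 * (fst (quat_mult a b (0, x, y, z) w))\<^sup>2
     - quat_norm a b (0, x, y, z) * (quat_norm a b w - 2 * (fst w)\<^sup>2)"
  by (cases w) (simp add: power2_eq_square algebra_simps)

lemma quat_inner_eq_fst: "quat_inner a b p q = fst (quat_mult a b (quat_conj p) q)"
  by (cases p; cases q) simp

lemma fst_quat_mult_commute: "fst (quat_mult a b p q) = fst (quat_mult a b q p)"
  by (cases p; cases q) (simp add: algebra_simps)

text \<open>This is multiplicativity of the norm for
  \<open>(e + \<alpha> h) (p + \<alpha> l) (e - \<alpha> h)\<^sup>*\<close> with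
  \<open>\<alpha>\<^sup>2 = c\<close>, written over the base field: \<open>A - c B + c l C\<close>
  is the part without \<alpha>, and \<open>t\<close> is the coefficient of \<alpha>. The identity is
  polynomial in \<open>c\<close>, so no extension has to be constructed.\<close>

lemma quat_norm_twisted_product:
  fixes a b c l x y z :: "'a::field" and e h :: "'a quat"
  defines "p \<equiv> (0, x, y, z)"
    and "A \<equiv> quat_mult a b (quat_mult a b e (0, x, y, z)) (quat_conj e)"
    and "B \<equiv> quat_mult a b (quat_mult a b h (0, x, y, z)) (quat_conj h)"
    and "C \<equiv> quat_mult a b h (quat_conj e) - quat_mult a b e (quat_conj h)"
    and "t \<equiv> 2 * fst (quat_mult a b (quat_mult a b h (0, x, y, z)) (quat_conj e))
               + l * (quat_norm a b e - c * quat_norm a b h)"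
  shows "- quat_norm a b (A - quat_smult c B + quat_smult (c * l) C) - c * t\<^sup>2 =
    (- quat_norm a b p - c * l\<^sup>2) *
    ((quat_norm a b e + c * quat_norm a b h)\<^sup>2 - 4 * c * (quat_inner a b e h)\<^sup>2)"
proof -
  define r where "r = fst (quat_mult a b (quat_mult a b h p) (quat_conj e))"
  define n where "n = quat_norm a b p"
  define E where "E = quat_norm a b e"
  define H where "H = quat_norm a b h"
  define q where "q = quat_inner a b e h"
  have NA: "quat_norm a b A = E\<^sup>2 * n" and NB: "quat_norm a b B = H\<^sup>2 * n"
    by (simp_all add: A_def B_def E_def H_def n_def p_def quat_norm_mult power2_eq_square)
  \<comment> \<open>Moving the outer factors \<open>e\<close> across the bilinear form turns the
    product of \<open>A\<close> and \<open>B\<close> into that of \<open>p\<close> with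
    \<open>w p w\<^sup>*\<close>.\<close>
  define w where "w = quat_mult a b (quat_conj e) h"
  have Nw: "quat_norm a b w = E * H" by (simp add: w_def E_def H_def quat_norm_mult)
  have fw: "fst w = q" by (simp add: w_def q_def quat_inner_eq_fst)
  have fpw: "fst (quat_mult a b p w) = r"
    unfolding w_def r_def
    by (metis quat_mult_assoc fst_quat_mult_commute)
  have "quat_inner a b A B = quat_inner a b p (quat_mult a b (quat_mult a b w p) (quat_conj w))"
    unfolding A_def B_def w_def p_def
    by (subst quat_inner_mult_right, subst quat_inner_mult_left)
      (simp only: quat_conj_mult quat_conj_conj quat_mult_assoc)
  also have "\<dots> = 2 * r\<^sup>2 - n * (E * H - 2 * q\<^sup>2)"
    unfolding p_def quat_inner_conjugate_pure
    using fpw fw Nw by (simp add: p_def n_def)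
  finally have AB: "quat_inner a b A B = 2 * r\<^sup>2 - n * (E * H - 2 * q\<^sup>2)" .
  have AC: "quat_inner a b A C = - 2 * r * E"
    unfolding A_def C_def r_def E_def p_def
    by (cases e; cases h) (simp add: algebra_simps)
  have BC: "quat_inner a b B C = - 2 * r * H"
    unfolding B_def C_def r_def H_def p_def
    by (cases e; cases h) (simp add: algebra_simps)
  have CC: "quat_norm a b C = 4 * E * H - 4 * q\<^sup>2"
    unfolding C_def E_def H_def q_def
    by (cases e; cases h) (simp add: power2_eq_square algebra_simps)
  have CA: "quat_inner a b C A = - 2 * r * E" and CB: "quat_inner a b C B = - 2 * r * H"
    and BA: "quat_inner a b B A = 2 * r\<^sup>2 - n * (E * H - 2 * q\<^sup>2)"
    using AC BC AB by (simp_all add: quat_inner_commute)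
  have t: "t = 2 * r + l * (E - c * H)"
    by (simp add: t_def r_def E_def H_def p_def)
  show ?thesis
    unfolding quat_inner_add quat_inner_diff quat_inner_smult NA NB AB BA AC CA BC CB CC t
    unfolding n_def[symmetric] E_def[symmetric] H_def[symmetric] q_def[symmetric]
    by (simp add: power2_eq_square algebra_simps)
qed

text \<open>Conjugation changes the sign of each of the three summands.\<close>

lemma fst_twisted_product:
  "fst (quat_mult a b (quat_mult a b e (0, x, y, z)) (quat_conj e)
     - quat_smult c (quat_mult a b (quat_mult a b h (0, x, y, z)) (quat_conj h))
     + quat_smult d (quat_mult a b h (quat_conj e) - quat_mult a b e (quat_conj h))) = 0"
  by (cases e; cases h) (simp add: algebra_simps)

section \<open>The pure part as a ternary form: the squares of the quaternions
  \<open>xi + yj + zij\<close>\<close>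

definition pure_form :: "'a::field \<Rightarrow> 'a \<Rightarrow> 'a \<times> 'a \<times> 'a \<Rightarrow> 'a" where
  "pure_form a b = (\<lambda>(x, y, z). a * x\<^sup>2 + b * y\<^sup>2 - a * b * z\<^sup>2)"

lemma pure_form_simp [simp]: "pure_form a b (x, y, z) = a * x\<^sup>2 + b * y\<^sup>2 - a * b * z\<^sup>2"
  by (simp add: pure_form_def)

lemma quat_norm_eq_pure_form: "quat_norm a b (w, p) = w\<^sup>2 - pure_form a b p"
  by (cases p) (simp add: power2_eq_square algebra_simps)

text \<open>On \<open>c\<close> times the isotropic vector plus the \<open>j\<close>-th basis
  vector, the form is an affine function of \<open>c\<close> with slope
  \<open>2 * d j * x j\<close>, which is nonzero.\<close>

lemma isotropic_diagonal_universal: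
  fixes d x :: "'i \<Rightarrow> 'a::field"
  assumes two: "(2::'a) \<noteq> 0" and fin: "finite I" and iso: "(\<Sum>i\<in>I. d i * (x i)\<^sup>2) = 0"
    and j: "j \<in> I" "x j \<noteq> 0" "d j \<noteq> 0"
  obtains y where "(\<Sum>i\<in>I. d i * (y i)\<^sup>2) = e"
proof -
  define c where "c = (e - d j) / (2 * d j * x j)"
  have "(\<Sum>i\<in>I. d i * (c * x i + (if i = j then 1 else 0))\<^sup>2) =
      (\<Sum>i\<in>I. c\<^sup>2 * (d i * (x i)\<^sup>2) + (if i = j then 2 * c * d j * x j + d j else 0))"
    by (rule sum.cong) (auto simp: power2_eq_square algebra_simps)
  also have "\<dots> = c\<^sup>2 * (\<Sum>i\<in>I. d i * (x i)\<^sup>2) + (2 * c * d j * x j + d j)"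
    using fin j by (simp add: sum.distrib sum_distrib_left)
  also have "2 * c * d j * x j = (e - d j) / (2 * d j * x j) * (2 * d j * x j)"
    by (simp add: c_def)
  also have "\<dots> = e - d j" using two j by simp
  also have "c\<^sup>2 * (\<Sum>i\<in>I. d i * (x i)\<^sup>2) + (e - d j + d j) = e" using iso by simp
  finally show ?thesis by (rule that)
qed

lemma pure_form_isotropic_universal:
  fixes a b :: "'a::field"
  assumes two: "(2::'a) \<noteq> 0" and ab: "a \<noteq> 0" "b \<noteq> 0"
    and iso: "pure_form a b p = 0" "p \<noteq> (0, 0, 0)"
  obtains q where "pure_form a b q = e"
proof -
  obtain x y z where p: "p = (x, y, z)" by (cases p)
  define d where "d = (!) [a, b, - a * b]"
  define v where "v = (!) [x, y, z]"
  have "(\<Sum>i\<in>{..<3::nat}. d i * (v i)\<^sup>2) = 0"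
    using iso by (simp add: p d_def v_def numeral_3_eq_3)
  moreover have "\<exists>j\<in>{..<3::nat}. v j \<noteq> 0 \<and> d j \<noteq> 0"
  proof -
    have "v 0 \<noteq> 0 \<or> v 1 \<noteq> 0 \<or> v 2 \<noteq> 0" using iso by (auto simp: p v_def)
    moreover have "d 0 \<noteq> 0" "d 1 \<noteq> 0" "d 2 \<noteq> 0" using ab by (auto simp: d_def)
    ultimately show ?thesis by fastforce
  qed
  ultimately obtain y where "(\<Sum>i\<in>{..<3::nat}. d i * (y i)\<^sup>2) = e"
    using isotropic_diagonal_universal[OF two, of "{..<3::nat}" d v] by (metis finite_lessThan)
  then have "pure_form a b (y 0, y 1, y 2) = e"
    by (simp add: d_def numeral_3_eq_3 numeral_2_eq_2)
  then show ?thesis by (rule that)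
qed

text \<open>Up to sign, the three candidates are the pure parts of the products of \<open>xi + yj + zij\<close> with
  \<open>ij\<close>, \<open>j\<close> and \<open>i\<close>.\<close>

lemma pure_form_orthogonal:
  fixes a b :: "'a::field"
  assumes two: "(2::'a) \<noteq> 0" and ab: "a \<noteq> 0" "b \<noteq> 0"
    and f: "pure_form a b (x, y, z) \<noteq> 0"
  obtains x' y' z' where "a * x * x' + b * y * y' - a * b * z * z' = 0"
    and "pure_form a b (x', y', z') \<noteq> 0"
proof -
  consider "a * x\<^sup>2 + b * y\<^sup>2 \<noteq> 0" | "x\<^sup>2 - b * z\<^sup>2 \<noteq> 0" | "y\<^sup>2 - a * z\<^sup>2 \<noteq> 0"
  proof -
    have False if "a * x\<^sup>2 + b * y\<^sup>2 = 0" "x\<^sup>2 = b * z\<^sup>2" "y\<^sup>2 = a * z\<^sup>2"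
    proof -
      have "2 * (a * b * z\<^sup>2) = a * x\<^sup>2 + b * y\<^sup>2" by (simp add: that(2,3))
      then have "z\<^sup>2 = 0" using that(1) two ab by simp
      then show False using f that by simp
    qed
    then show ?thesis using that by fastforce
  qed
  then show ?thesis
  proof cases
    case 1
    have "pure_form a b (b * y, - a * x, 0) = a * b * (a * x\<^sup>2 + b * y\<^sup>2)"
      by (simp add: power2_eq_square algebra_simps)
    then show ?thesis using 1 ab by (intro that[of "b * y" "- a * x" 0]) auto
  next
    case 2
    have "pure_form a b (b * z, 0, x) = - a * b * (x\<^sup>2 - b * z\<^sup>2)"
      by (simp add: power2_eq_square algebra_simps)
    then show ?thesis using 2 ab by (intro that[of "b * z" 0 x]) auto
  next
    case 3
    have "pure_form a b (0, a * z, y) = - a * b * (y\<^sup>2 - a * z\<^sup>2)"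
      by (simp add: power2_eq_square algebra_simps)
    then show ?thesis using 3 ab by (intro that[of 0 "a * z" y]) auto
  qed
qed

text \<open>Orthogonal pure quaternions \<open>P\<close> and \<open>R\<close> anticommute, so they
  behave like new standard generators. The vector on the left is \<open>X P + Y R + Z P R\<close> in
  the old coordinates.\<close>

lemma pure_form_change_slot:
  fixes a b :: "'a::field"
  assumes "a * x * x' + b * y * y' - a * b * z * z' = 0"
  shows "pure_form a b (X * x + Y * x' + Z * (b * (z * y' - y * z')),
      X * y + Y * y' + Z * (a * (x * z' - z * x')), X * z + Y * z' + Z * (x * y' - y * x')) =
    pure_form (pure_form a b (x, y, z)) (pure_form a b (x', y', z')) (X, Y, Z)"
proof -
  \<comment> \<open>The defect is an explicit multiple of the orthogonality relation, which leaves a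
    polynomial identity.\<close>
  have "pure_form a b (X * x + Y * x' + Z * (b * (z * y' - y * z')),
      X * y + Y * y' + Z * (a * (x * z' - z * x')), X * z + Y * z' + Z * (x * y' - y * x')) -
    pure_form (pure_form a b (x, y, z)) (pure_form a b (x', y', z')) (X, Y, Z) =
    (a * x * x' + b * y * y' - a * b * z * z') *
    (2 * X * Y + Z\<^sup>2 * (a * x * x' + b * y * y' - a * b * z * z'))"
    by (simp add: power2_eq_square algebra_simps)
  then show ?thesis using assms by simp
qed

lemma half_squares:
  fixes g :: "'a::field"
  assumes "(2::'a) \<noteq> 0"
  shows "((g + 1) / 2)\<^sup>2 - ((g - 1) / 2)\<^sup>2 = g"
proof -
  have "((g + 1) / 2)\<^sup>2 - ((g - 1) / 2)\<^sup>2 = ((g + 1)\<^sup>2 - (g - 1)\<^sup>2) / (2 * 2)"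
    unfolding power_divide power2_eq_square[of 2] by (rule diff_divide_distrib[symmetric])
  also have "(g + 1)\<^sup>2 - (g - 1)\<^sup>2 = g * (2 * 2)"
    by (simp add: power2_eq_square algebra_simps)
  also have "g * (2 * 2) / (2 * 2) = g"
    using assms by (intro nonzero_mult_div_cancel_right) (metis mult_eq_0_iff)
  finally show ?thesis .
qed

text \<open>If \<open>w\<close> is nonzero, the pure part represents the square
  \<open>w\<^sup>2\<close>. Taking this as a slot, with second slot \<open>d\<close>, exposes the
  binary form \<open>d (Y\<^sup>2 - (w Z)\<^sup>2)\<close>, a hyperbolic plane, which takes every
  value.\<close>

lemma quat_norm_isotropic_imp_pure_form_universal:
  fixes a b :: "'a::field"
  assumes two: "(2::'a) \<noteq> 0" and ab: "a \<noteq> 0" "b \<noteq> 0"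
    and iso: "quat_norm a b (w, p) = 0" "(w, p) \<noteq> (0, 0, 0, 0)"
  obtains q where "pure_form a b q = e"
proof (cases "w = 0")
  case True
  then show ?thesis
    using iso that pure_form_isotropic_universal[OF two ab, of p e]
    by (auto simp: quat_norm_eq_pure_form)
next
  case False
  obtain x y z where p: "p = (x, y, z)" by (cases p)
  have "pure_form a b (x, y, z) = w\<^sup>2"
    using iso by (simp add: quat_norm_eq_pure_form p del: quat_inner.simps)
  then have *: "pure_form a b (x, y, z) \<noteq> 0" using False by simp
  obtain x' y' z' where o: "a * x * x' + b * y * y' - a * b * z * z' = 0"
    and d: "pure_form a b (x', y', z') \<noteq> 0" (is "?d \<noteq> 0")
    using pure_form_orthogonal[OF two ab *] by metis
  define Y where "Y = (e / ?d + 1) / 2"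
  define Z where "Z = (e / ?d - 1) / (2 * w)"
  have "pure_form (w\<^sup>2) ?d (0, Y, Z) = ?d * (Y\<^sup>2 - (w * Z)\<^sup>2)"
    unfolding pure_form_simp by (simp add: power2_eq_square algebra_simps)
  also have "w * Z = (e / ?d - 1) / 2" using False by (simp add: Z_def)
  also have "Y\<^sup>2 - ((e / ?d - 1) / 2)\<^sup>2 = e / ?d"
    unfolding Y_def by (rule half_squares[OF two])
  finally have "pure_form (w\<^sup>2) ?d (0, Y, Z) = e" using d by simp
  then show ?thesis
    using pure_form_change_slot[OF o, of 0 Y Z] that \<open>pure_form a b (x, y, z) = w\<^sup>2\<close> by metis
qed

section \<open>Common values of pure parts\<close>

text \<open>
  For pure \<open>p\<close> with coordinates \<open>i, j, k\<close> and a square root \<open>\<alpha>\<close> of \<open>c\<close>, the product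
  \<open>(e + \<alpha> h) (p + \<alpha> l) (e - \<alpha> h)\<^sup>*\<close> is a pure quaternion plus \<open>\<alpha>\<close> times the value of \<open>skew_part\<close>.
\<close>

definition skew_part :: "'a::field \<Rightarrow> 'a \<Rightarrow> 'a \<Rightarrow> 'a \<times> 'a \<times> 'a \<Rightarrow> 'a \<Rightarrow> 'a quat \<Rightarrow> 'a quat \<Rightarrow> 'a" where
  "skew_part a b c p l e h =
     2 * fst (quat_mult a b (quat_mult a b h (0, p)) (quat_conj e))
     + l * (quat_norm a b e - c * quat_norm a b h)"

text \<open>The part of the twisted product without \<alpha> is pure, so its norm is minus a value
  of \<open>pure_form\<close>. The last factor is the product of the norms of
  \<open>e + \<alpha> h\<close> and \<open>e - \<alpha> h\<close>.\<close>

lemma pure_form_skew_part: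
  "\<exists>q. pure_form a b q - c * (skew_part a b c p l e h)\<^sup>2 =
      (pure_form a b p - c * l\<^sup>2) *
      ((quat_norm a b e + c * quat_norm a b h)\<^sup>2 - 4 * c * (quat_inner a b e h)\<^sup>2)"
proof -
  obtain i j k where p: "p = (i, j, k)" by (cases p)
  let ?G = "quat_mult a b (quat_mult a b e (0, i, j, k)) (quat_conj e)
   - quat_smult c (quat_mult a b (quat_mult a b h (0, i, j, k)) (quat_conj h))
   + quat_smult (c * l) (quat_mult a b h (quat_conj e) - quat_mult a b e (quat_conj h))"
  obtain w q where G: "?G = (w, q)" by (cases ?G)
  have "w = 0" using fst_twisted_product[of a b e i j k c h "c * l"] by (simp only: G fst_conv)
  have "- quat_norm a b (w, q) - c * (skew_part a b c p l e h)\<^sup>2 =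
    (- quat_norm a b (0, p) - c * l\<^sup>2) *
    ((quat_norm a b e + c * quat_norm a b h)\<^sup>2 - 4 * c * (quat_inner a b e h)\<^sup>2)"
    unfolding skew_part_def p G[symmetric] by (rule quat_norm_twisted_product)
  then show ?thesis
    by (intro exI[of _ q]) (simp add: quat_norm_eq_pure_form \<open>w = 0\<close> del: quat_inner.simps)
qed

section \<open>Consequences of isotropy in five variables\<close>

locale isotropic_dim5 =
  fixes field_type :: "'a::field itself"
  assumes two: "(2::'a) \<noteq> 0"
    and not_anisotropic: "\<And>q :: 'a vec \<Rightarrow> 'a. quadratic_form (coord_space 5) q \<Longrightarrow> \<not> anisotropic (coord_space 5) q"
begin

text \<open>The diagonal of a bilinear map is a quadratic form with polar form
  \<open>B x y + B y x\<close>; giving \<open>B\<close> reduces the axioms of a quadratic form to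
  linearity.\<close>

lemma isotropic_five_variables:
  fixes B :: "'a vec \<Rightarrow> 'a vec \<Rightarrow> 'a"
  assumes add: "\<And>x y z. \<lbrakk>x \<in> carrier_vec 5; y \<in> carrier_vec 5; z \<in> carrier_vec 5\<rbrakk> \<Longrightarrow> B (x + y) z = B x z + B y z"
      "\<And>x y z. \<lbrakk>x \<in> carrier_vec 5; y \<in> carrier_vec 5; z \<in> carrier_vec 5\<rbrakk> \<Longrightarrow> B z (x + y) = B z x + B z y"
    and smult: "\<And>c x y. \<lbrakk>x \<in> carrier_vec 5; y \<in> carrier_vec 5\<rbrakk> \<Longrightarrow> B (c \<cdot>\<^sub>v x) y = c * B x y"
      "\<And>c x y. \<lbrakk>x \<in> carrier_vec 5; y \<in> carrier_vec 5\<rbrakk> \<Longrightarrow> B x (c \<cdot>\<^sub>v y) = c * B x y"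
  obtains v where "B v v = 0" "(v $ 0, v $ 1, v $ 2, v $ 3, v $ 4) \<noteq> (0, 0, 0, 0, 0)"
proof -
  have "quadratic_form (coord_space 5) (\<lambda>v. B v v)"
    unfolding quadratic_form_def polar_form_def
    by (auto simp: vec_vs module_vec_simps add smult power2_eq_square algebra_simps)
  then obtain v where v: "v \<in> carrier_vec 5" "B v v = 0" "v \<noteq> 0\<^sub>v 5"
    using not_anisotropic by (auto simp: anisotropic_def module_vec_simps)
  have "(v $ 0, v $ 1, v $ 2, v $ 3, v $ 4) \<noteq> (0, 0, 0, 0, 0)"
  proof
    assume "(v $ 0, v $ 1, v $ 2, v $ 3, v $ 4) = (0, 0, 0, 0, 0)"
    then have "v $ i = 0" if "i < 5" for i
      using that by (auto simp: less_Suc_eq eval_nat_numeral)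
    then have "v = 0\<^sub>v 5" using v(1) by (intro eq_vecI) auto
    then show False using v(3) by simp
  qed
  then show ?thesis using that v(2) by blast
qed

lemma isotropic_diagonal5:
  fixes d1 d2 d3 d4 d5 :: 'a
  obtains x1 x2 x3 x4 x5 where "d1 * x1\<^sup>2 + d2 * x2\<^sup>2 + d3 * x3\<^sup>2 + d4 * x4\<^sup>2 + d5 * x5\<^sup>2 = 0"
    "(x1, x2, x3, x4, x5) \<noteq> (0, 0, 0, 0, 0)"
proof -
  obtain v where "d1 * v $ 0 * v $ 0 + d2 * v $ 1 * v $ 1 + d3 * v $ 2 * v $ 2 + d4 * v $ 3 * v $ 3 +
      d5 * v $ 4 * v $ 4 = 0" "(v $ 0, v $ 1, v $ 2, v $ 3, v $ 4) \<noteq> (0, 0, 0, 0, 0)"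
    by (rule isotropic_five_variables
        [of "\<lambda>x y. d1 * x $ 0 * y $ 0 + d2 * x $ 1 * y $ 1 + d3 * x $ 2 * y $ 2 + d4 * x $ 3 * y $ 3 +
          d5 * x $ 4 * y $ 4"])
      (simp_all add: algebra_simps)
  then show ?thesis
    using that[of "v $ 0" "v $ 1" "v $ 2" "v $ 3" "v $ 4"] by (simp add: power2_eq_square mult.assoc)
qed

text \<open>Putting the last coordinate of the second pure part to 0 leaves a five-dimensional
  subform of the Albert form of the two algebras. If its isotropic vector only gives the common
  value 0, one of the pure parts is isotropic, hence universal, and represents the first slot of the
  other.\<close>

lemma pure_form_common_value:
  fixes a b c d :: 'a
  assumes "a \<noteq> 0" "b \<noteq> 0" "c \<noteq> 0" "d \<noteq> 0"
  obtains p q where "pure_form a b p = pure_form c d q" "pure_form a b p \<noteq> 0"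
proof -
  obtain x y z x' y' where
    iso: "a * x\<^sup>2 + b * y\<^sup>2 + - (a * b) * z\<^sup>2 + - c * x'\<^sup>2 + - d * y'\<^sup>2 = 0"
    and nz: "(x, y, z, x', y') \<noteq> (0, 0, 0, 0, 0)"
    by (rule isotropic_diagonal5)
  have eq: "pure_form a b (x, y, z) = pure_form c d (x', y', 0)"
    using iso by (simp add: algebra_simps)
  consider "pure_form a b (x, y, z) \<noteq> 0"
    | "pure_form a b (x, y, z) = 0" "(x, y, z) \<noteq> (0, 0, 0)"
    | "pure_form c d (x', y', 0) = 0" "(x', y', 0::'a) \<noteq> (0, 0, 0)"
    using nz eq by force
  then show ?thesis
  proof cases
    case 1
    then show ?thesis using that eq by blast
  next
    case 2
    then obtain p where "pure_form a b p = c"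
      using pure_form_isotropic_universal[OF two assms(1,2)] by metis
    then show ?thesis using that[of p "(1, 0, 0)"] assms by simp
  next
    case 3
    then obtain q where "pure_form c d q = a"
      using pure_form_isotropic_universal[OF two assms(3,4)] by metis
    then show ?thesis using that[of "(1, 0, 0)" q] assms by simp
  qed
qed

text \<open>Adjoin the coefficient \<open>- e\<close> as a fifth one. An isotropic vector either has
  a nonzero last coordinate, by which one divides, or shows that the four-dimensional form is itself
  isotropic and so universal.\<close>

lemma pure_form_minus_universal:
  fixes a b c e :: 'a
  assumes nz: "a \<noteq> 0" "b \<noteq> 0" "c \<noteq> 0"
  obtains p l where "pure_form a b p - c * l\<^sup>2 = e"
proof -
  obtain x1 x2 x3 x4 x5 where
    iso: "a * x1\<^sup>2 + b * x2\<^sup>2 + - (a * b) * x3\<^sup>2 + - c * x4\<^sup>2 + - e * x5\<^sup>2 = 0"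
    and x: "(x1, x2, x3, x4, x5) \<noteq> (0, 0, 0, 0, 0)"
    by (rule isotropic_diagonal5)
  show ?thesis
  proof (cases "x5 = 0")
    case False
    have "pure_form a b (x1 / x5, x2 / x5, x3 / x5) - c * (x4 / x5)\<^sup>2 = e"
      using iso False by (simp add: field_simps)
    then show ?thesis by (rule that)
  next
    case True
    define d where "d = (!) [a, b, - (a * b), - c]"
    define v where "v = (!) [x1, x2, x3, x4]"
    have "(\<Sum>i\<in>{..<4::nat}. d i * (v i)\<^sup>2) = 0"
      using iso True by (simp add: d_def v_def eval_nat_numeral)
    moreover have "\<exists>j\<in>{..<4::nat}. v j \<noteq> 0 \<and> d j \<noteq> 0"
    proof -
      have "v 0 \<noteq> 0 \<or> v 1 \<noteq> 0 \<or> v 2 \<noteq> 0 \<or> v 3 \<noteq> 0" using x True by (auto simp: v_def)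
      moreover have "d 0 \<noteq> 0" "d 1 \<noteq> 0" "d 2 \<noteq> 0" "d 3 \<noteq> 0" using nz by (auto simp: d_def)
      ultimately show ?thesis by fastforce
    qed
    ultimately obtain y where "(\<Sum>i\<in>{..<4::nat}. d i * (y i)\<^sup>2) = e"
      using isotropic_diagonal_universal[OF two, of "{..<4::nat}" d v] by (metis finite_lessThan)
    then have "pure_form a b (y 0, y 1, y 2) - c * (y 3)\<^sup>2 = e"
      by (simp add: d_def eval_nat_numeral)
    then show ?thesis by (rule that)
  qed
qed

text \<open>All coordinates are linear in the five parameters, so the difference of the two skew
  parts is a quadratic form in five variables.\<close>

lemma skew_part_common_value:
  fixes m u1 u2 a s v w l1 l2 :: 'a
  obtains x1 x2 x3 x4 t where "(x1, x2, x3, x4, t) \<noteq> (0, 0, 0, 0, 0)"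
    "skew_part m u1 a p1 l1 (x1, x2, 0, s * t) (x3, x4, t, 0) =
     skew_part m u2 a p2 l2 (x1, x2, v * t, w * t) (x3, x4, 0, 0)"
proof -
  \<comment> \<open>\<open>S\<close> is bilinear in the pairs \<open>(e, h)\<close> and
    \<open>(e', h')\<close>, and its diagonal is \<open>skew_part\<close>.\<close>
  define S where "S u p l e h e' h' =
    2 * fst (quat_mult m u (quat_mult m u h (0, p)) (quat_conj e'))
    + l * (quat_inner m u e e' - a * quat_inner m u h h')" for u p l e h e' h'
  define E1 where "E1 x = (x $ 0, x $ 1, 0::'a, s * x $ 4)" for x :: "'a vec"
  define H1 where "H1 x = (x $ 2, x $ 3, x $ 4, 0::'a)" for x :: "'a vec"
  define E2 where "E2 x = (x $ 0, x $ 1, v * x $ 4, w * x $ 4)" for x :: "'a vec"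
  define H2 where "H2 x = (x $ 2, x $ 3, 0::'a, 0::'a)" for x :: "'a vec"
  define B where "B x y = S u1 p1 l1 (E1 x) (H1 x) (E1 y) (H1 y) - S u2 p2 l2 (E2 x) (H2 x) (E2 y) (H2 y)" for x y
  obtain i1 j1 k1 where p1: "p1 = (i1, j1, k1)" by (cases p1)
  obtain i2 j2 k2 where p2: "p2 = (i2, j2, k2)" by (cases p2)
  obtain x where "B x x = 0" and "(x $ 0, x $ 1, x $ 2, x $ 3, x $ 4) \<noteq> (0, 0, 0, 0, 0)"
    by (rule isotropic_five_variables[of B])
      (simp_all add: B_def S_def E1_def H1_def E2_def H2_def p1 p2 algebra_simps)
  then show ?thesis
    using that[of "x $ 0" "x $ 1" "x $ 2" "x $ 3" "x $ 4"]
    by (simp add: B_def S_def E1_def H1_def E2_def H2_def skew_part_def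
        del: quat_mult.simps quat_inner.simps quat_conj.simps)
qed

text \<open>The hypotheses say that \<open>e + \<alpha> h\<close>, with
  \<open>\<alpha>\<^sup>2 = c\<close>, is nonzero of norm 0. If \<open>h\<close> has nonzero norm,
  then \<open>e\<^sup>* h\<close> divided by that norm is a pure quaternion with square
  \<open>c\<close>. Otherwise \<open>e\<close> has norm 0 too, the norm is isotropic and the pure
  part is universal.\<close>

lemma pure_form_represents_of_norm_zero:
  fixes a b c :: 'a
  assumes nz: "a \<noteq> 0" "b \<noteq> 0"
    and eh: "quat_norm a b e + c * quat_norm a b h = 0" "quat_inner a b e h = 0"
    and ne: "(e, h) \<noteq> ((0, 0, 0, 0), (0, 0, 0, 0))"
  obtains q where "pure_form a b q = c"
proof (cases "quat_norm a b h = 0")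
  case True
  then have "quat_norm a b e = 0" using eh by simp
  then obtain k where "quat_norm a b k = 0" "k \<noteq> (0, 0, 0, 0)"
    using True ne by metis
  then show ?thesis
    using that quat_norm_isotropic_imp_pure_form_universal[OF two nz] by (metis prod.collapse)
next
  case False
  let ?H = "quat_norm a b h"
  obtain w x y z where k: "quat_smult (1 / ?H) (quat_mult a b (quat_conj e) h) = (w, x, y, z)"
    by (metis prod.collapse)
  have w: "w = 0"
  proof -
    have "w = fst (quat_smult (1 / ?H) (quat_mult a b (quat_conj e) h))" by (simp add: k)
    also have "\<dots> = (1 / ?H) * fst (quat_mult a b (quat_conj e) h)"
      by (cases "quat_mult a b (quat_conj e) h") simp
    finally show ?thesis using eh(2) by (simp add: quat_inner_eq_fst del: quat_inner.simps)
  qed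
  have "quat_norm a b (w, x, y, z) = (1 / ?H) * ((1 / ?H) * (quat_norm a b e * ?H))"
    unfolding k[symmetric] quat_inner_smult quat_norm_mult by simp
  also have "\<dots> = - c"
    using eh(1) False by (simp add: eq_neg_iff_add_eq_0 [symmetric] del: quat_inner.simps)
  finally have "pure_form a b (x, y, z) = c"
    using w by (simp add: quat_norm_eq_pure_form del: quat_inner.simps pure_form_simp)
  then show ?thesis by (rule that)
qed

text \<open>
  With \<open>\<alpha>\<close> a square root of \<open>a\<close>, \<open>(m, u\<^sub>1)\<close> and \<open>(m, u\<^sub>2)\<close> become isomorphic over \<open>F(\<alpha>)\<close>. The vectors
  \<open>e + \<alpha> h\<close> and \<open>e' + \<alpha> h'\<close> correspond to each other in a five-dimensional \<open>F\<close>-subspace: they have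
  the same norm over \<open>F(\<alpha>)\<close>.
\<close>

lemma pure_form_common_value3_normalized:
  fixes m u1 u2 a b :: 'a
  assumes nz: "m \<noteq> 0" "u1 \<noteq> 0" "u2 \<noteq> 0" "a \<noteq> 0" "b \<noteq> 0"
    and a: "a = pure_form m (u1 * u2) (s, w0, w1)"
  obtains p q r where "pure_form m u1 p = pure_form a b r" "pure_form m u2 q = pure_form a b r"
    "pure_form a b r \<noteq> 0"
proof (cases "w0 = 0 \<and> w1 = 0 \<or> (\<exists>r. r \<noteq> (0, 0, 0) \<and> pure_form a b r = 0)")
  case True
  \<comment> \<open>In the degenerate cases the pure part of \<open>(a, b)\<close> represents
    \<open>m\<close>, which is already a slot of the other two algebras: either \<open>a\<close> is
    \<open>m\<close> times a square, or this pure part is isotropic and hence universal.\<close>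
  have "\<exists>r. pure_form a b r = m"
  proof (cases "w0 = 0 \<and> w1 = 0")
    case True
    then have "pure_form a b (1 / s, 0, 0) = m" using a nz by (simp add: power_divide)
    then show ?thesis ..
  next
    case False
    then show ?thesis
      using True pure_form_isotropic_universal[OF two nz(4,5)] by metis
  qed
  then obtain r where "pure_form a b r = m" ..
  then show ?thesis using that[of "(1, 0, 0)" r "(1, 0, 0)"] nz by simp
next
  case False
  \<comment> \<open>Over \<open>F(\<alpha>)\<close>, \<open>p1 + \<alpha> l1\<close> and
    \<open>p2 + \<alpha> l2\<close> are elements of norm \<open>- b\<close> in the two
    algebras.\<close>
  obtain p1 l1 where g1: "pure_form m u1 p1 - a * l1\<^sup>2 = b"
    using pure_form_minus_universal nz by metis
  obtain p2 l2 where g2: "pure_form m u2 p2 - a * l2\<^sup>2 = b"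
    using pure_form_minus_universal nz by metis
  \<comment> \<open>The coordinates along 1 and the common generator of square \<open>m\<close> are
    shared. In the remaining two, \<open>(\<alpha> t, s t)\<close> corresponds to
    \<open>(u1 w0 t, u1 w1 t)\<close>; the norms agree because
    \<open>a - m s\<^sup>2 = u1 u2 (w0\<^sup>2 - m w1\<^sup>2)\<close>.\<close>
  obtain x1 x2 x3 x4 t where x: "(x1, x2, x3, x4, t) \<noteq> (0, 0, 0, 0, 0)"
    and Q: "skew_part m u1 a p1 l1 (x1, x2, 0, s * t) (x3, x4, t, 0) =
     skew_part m u2 a p2 l2 (x1, x2, u1 * w0 * t, u1 * w1 * t) (x3, x4, 0, 0)"
    by (rule skew_part_common_value)
  define e where "e = (x1, x2, 0::'a, s * t)"
  define h where "h = (x3, x4, t, 0::'a)"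
  define e' where "e' = (x1, x2, u1 * w0 * t, u1 * w1 * t)"
  define h' where "h' = (x3, x4, 0::'a, 0::'a)"
  define T where "T = quat_norm m u1 e + a * quat_norm m u1 h"
  define B where "B = quat_inner m u1 e h"
  have T': "quat_norm m u2 e' + a * quat_norm m u2 h' = T"
    unfolding e'_def h'_def T_def e_def h_def a by (simp add: power2_eq_square algebra_simps)
  have B': "quat_inner m u2 e' h' = B"
    by (simp add: e'_def h'_def B_def e_def h_def)
  define v where "v = skew_part m u1 a p1 l1 e h"
  have v': "skew_part m u2 a p2 l2 e' h' = v"
    using Q by (simp add: v_def e_def h_def e'_def h'_def)
  \<comment> \<open>The common norm of the two vectors is \<open>T + 2 B \<alpha>\<close>.
    Multiplying it by its conjugate gives \<open>T\<^sup>2 - 4 a B\<^sup>2\<close>, so the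
    right-hand side of \<open>pure_form_skew_part\<close>, with \<open>a v\<^sup>2\<close> added, is
    a value of the pure part of \<open>(a, b)\<close>.\<close>
  let ?f = "pure_form a b (v, T, 2 * B)"
  have f: "?f = a * v\<^sup>2 + b * (T\<^sup>2 - 4 * a * B\<^sup>2)"
    by (simp add: power2_eq_square algebra_simps)
  obtain p where "pure_form m u1 p - a * v\<^sup>2 = b * (T\<^sup>2 - 4 * a * B\<^sup>2)"
    using pure_form_skew_part[of m u1 a p1 l1 e h] unfolding g1 v_def T_def B_def by blast
  then have p: "pure_form m u1 p = ?f" unfolding f diff_eq_eq by (simp only: add.commute)
  obtain q where "pure_form m u2 q - a * v\<^sup>2 = b * (T\<^sup>2 - 4 * a * B\<^sup>2)"
    using pure_form_skew_part[of m u2 a p2 l2 e' h'] unfolding g2 v' T' B' by blast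
  then have q: "pure_form m u2 q = ?f" unfolding f diff_eq_eq by (simp only: add.commute)
  show ?thesis
  proof (cases "?f = 0")
    case True
    \<comment> \<open>Here the pure part of \<open>(a, b)\<close> is anisotropic, so both vectors
      have norm 0 over \<open>F(\<alpha>)\<close>. They are nonzero, the second one because
      \<open>w0\<close> and \<open>w1\<close> do not both vanish, so both algebras represent
      \<open>a\<close>.\<close>
    then have "(v, T, 2 * B) = (0, 0, 0)" using False by blast
    then have "T = 0" "B = 0" using two by auto
    have "(e, h) \<noteq> ((0, 0, 0, 0), (0, 0, 0, 0))" using x by (auto simp: e_def h_def)
    then obtain p where "pure_form m u1 p = a"
      using pure_form_represents_of_norm_zero nz \<open>T = 0\<close> \<open>B = 0\<close> unfolding T_def B_def by metis
    moreover have "(e', h') \<noteq> ((0, 0, 0, 0), (0, 0, 0, 0))"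
      using x False nz by (auto simp: e'_def h'_def)
    then obtain q where "pure_form m u2 q = a"
      using pure_form_represents_of_norm_zero nz \<open>T = 0\<close> \<open>B = 0\<close> T' B' by metis
    ultimately show ?thesis using that[of p "(1, 0, 0)" q] nz by simp
  next
    case False
    then show ?thesis using that p q by metis
  qed
qed

end

section \<open>Presentations of quaternion algebras\<close>

locale quaternion_presentation = assoc_algebra "class_ring :: 'a::field ring" Q
  for Q :: "('a::field, 'q) module" +
  fixes a b :: 'a and i j :: 'q
  assumes generators: "quaternion_generators Q a b i j"
begin

abbreviation comb :: "'a quat \<Rightarrow> 'q" where "comb \<equiv> quaternion_comb Q i j"

lemma gens [simp]: "a \<noteq> 0" "b \<noteq> 0" "i \<in> carrier Q" "j \<in> carrier Q"
  "i \<otimes>\<^bsub>Q\<^esub> i = a \<odot>\<^bsub>Q\<^esub> \<one>\<^bsub>Q\<^esub>" "j \<otimes>\<^bsub>Q\<^esub> j = b \<odot>\<^bsub>Q\<^esub> \<one>\<^bsub>Q\<^esub>"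
  and bij_comb: "bij_betw comb UNIV (carrier Q)"
  using generators by (auto simp: quaternion_generators_def)

lemma scalar_simps [simp]:
  "x \<in> carrier Q \<Longrightarrow> c \<odot>\<^bsub>Q\<^esub> x \<in> carrier Q"
  "x \<in> carrier Q \<Longrightarrow> c \<odot>\<^bsub>Q\<^esub> (d \<odot>\<^bsub>Q\<^esub> x) = (c * d) \<odot>\<^bsub>Q\<^esub> x"
  "x \<in> carrier Q \<Longrightarrow> 1 \<odot>\<^bsub>Q\<^esub> x = x"
  "x \<in> carrier Q \<Longrightarrow> 0 \<odot>\<^bsub>Q\<^esub> x = \<zero>\<^bsub>Q\<^esub>"
  "\<lbrakk>x \<in> carrier Q; y \<in> carrier Q\<rbrakk> \<Longrightarrow> (c \<odot>\<^bsub>Q\<^esub> x) \<otimes>\<^bsub>Q\<^esub> y = c \<odot>\<^bsub>Q\<^esub> (x \<otimes>\<^bsub>Q\<^esub> y)"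
  "\<lbrakk>x \<in> carrier Q; y \<in> carrier Q\<rbrakk> \<Longrightarrow> x \<otimes>\<^bsub>Q\<^esub> (c \<odot>\<^bsub>Q\<^esub> y) = c \<odot>\<^bsub>Q\<^esub> (x \<otimes>\<^bsub>Q\<^esub> y)"
  using smult_closed[of c x] smult_assoc1[of c d x] smult_one[of x] smult_l_null[of x]
    smult_mult_left[of c x y] smult_mult_right[of c x y]
  by (simp_all add: class_ring_simps)

lemma scalar_distrib:
  "x \<in> carrier Q \<Longrightarrow> (c + d) \<odot>\<^bsub>Q\<^esub> x = c \<odot>\<^bsub>Q\<^esub> x \<oplus>\<^bsub>Q\<^esub> d \<odot>\<^bsub>Q\<^esub> x"
  "\<lbrakk>x \<in> carrier Q; y \<in> carrier Q\<rbrakk> \<Longrightarrow> c \<odot>\<^bsub>Q\<^esub> (x \<oplus>\<^bsub>Q\<^esub> y) = c \<odot>\<^bsub>Q\<^esub> x \<oplus>\<^bsub>Q\<^esub> c \<odot>\<^bsub>Q\<^esub> y"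
  using smult_l_distr[of c d x] smult_r_distr[of c x y] by (simp_all add: class_ring_simps)

lemma uminus_eq_smult: "x \<in> carrier Q \<Longrightarrow> \<ominus>\<^bsub>Q\<^esub> x = (- 1) \<odot>\<^bsub>Q\<^esub> x"
  using smult_l_minus[of 1 x] by (simp add: class_ring_simps)

lemma ji [simp]: "j \<otimes>\<^bsub>Q\<^esub> i = (- 1) \<odot>\<^bsub>Q\<^esub> (i \<otimes>\<^bsub>Q\<^esub> j)"
  using generators uminus_eq_smult[of "i \<otimes>\<^bsub>Q\<^esub> j"] by (simp add: quaternion_generators_def)

lemma basis_mult [simp]:
  "i \<otimes>\<^bsub>Q\<^esub> (i \<otimes>\<^bsub>Q\<^esub> j) = a \<odot>\<^bsub>Q\<^esub> j"
  "i \<otimes>\<^bsub>Q\<^esub> j \<otimes>\<^bsub>Q\<^esub> i = (- a) \<odot>\<^bsub>Q\<^esub> j"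
  "j \<otimes>\<^bsub>Q\<^esub> (i \<otimes>\<^bsub>Q\<^esub> j) = (- b) \<odot>\<^bsub>Q\<^esub> i"
  "i \<otimes>\<^bsub>Q\<^esub> j \<otimes>\<^bsub>Q\<^esub> j = b \<odot>\<^bsub>Q\<^esub> i"
  "i \<otimes>\<^bsub>Q\<^esub> j \<otimes>\<^bsub>Q\<^esub> (i \<otimes>\<^bsub>Q\<^esub> j) = (- (a * b)) \<odot>\<^bsub>Q\<^esub> \<one>\<^bsub>Q\<^esub>"
proof -
  show 1: "i \<otimes>\<^bsub>Q\<^esub> (i \<otimes>\<^bsub>Q\<^esub> j) = a \<odot>\<^bsub>Q\<^esub> j"
    by (subst m_assoc[symmetric]) simp_all
  show "i \<otimes>\<^bsub>Q\<^esub> j \<otimes>\<^bsub>Q\<^esub> i = (- a) \<odot>\<^bsub>Q\<^esub> j"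
    by (subst m_assoc) (simp_all add: 1)
  have 4: "j \<otimes>\<^bsub>Q\<^esub> (i \<otimes>\<^bsub>Q\<^esub> j) = (- 1) \<odot>\<^bsub>Q\<^esub> (i \<otimes>\<^bsub>Q\<^esub> j \<otimes>\<^bsub>Q\<^esub> j)"
    by (subst m_assoc[symmetric]) simp_all
  show 3: "i \<otimes>\<^bsub>Q\<^esub> j \<otimes>\<^bsub>Q\<^esub> j = b \<odot>\<^bsub>Q\<^esub> i"
    by (subst m_assoc) simp_all
  show 2: "j \<otimes>\<^bsub>Q\<^esub> (i \<otimes>\<^bsub>Q\<^esub> j) = (- b) \<odot>\<^bsub>Q\<^esub> i"
    unfolding 4 3 by simp
  show "i \<otimes>\<^bsub>Q\<^esub> j \<otimes>\<^bsub>Q\<^esub> (i \<otimes>\<^bsub>Q\<^esub> j) = (- (a * b)) \<odot>\<^bsub>Q\<^esub> \<one>\<^bsub>Q\<^esub>"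
    by (subst m_assoc) (simp_all add: 2 mult.commute)
qed

lemma comb_eq: "comb (w, x, y, z) =
    w \<odot>\<^bsub>Q\<^esub> \<one>\<^bsub>Q\<^esub> \<oplus>\<^bsub>Q\<^esub> (x \<odot>\<^bsub>Q\<^esub> i \<oplus>\<^bsub>Q\<^esub> (y \<odot>\<^bsub>Q\<^esub> j \<oplus>\<^bsub>Q\<^esub> z \<odot>\<^bsub>Q\<^esub> (i \<otimes>\<^bsub>Q\<^esub> j)))"
  by (simp add: quaternion_comb_def a_assoc)

lemma comb_closed [simp]: "comb p \<in> carrier Q"
  by (cases p) (simp add: comb_eq)

lemma comb_add: "comb p \<oplus>\<^bsub>Q\<^esub> comb q = comb (p + q)"
  by (cases p; cases q) (simp add: comb_eq scalar_distrib a_ac)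

lemma comb_smult: "c \<odot>\<^bsub>Q\<^esub> comb p = comb (quat_smult c p)"
  by (cases p) (simp add: comb_eq scalar_distrib)

lemma comb_uminus: "\<ominus>\<^bsub>Q\<^esub> comb p = comb (- p)"
  by (cases p) (simp add: uminus_eq_smult comb_smult)

lemma comb_mult: "comb p \<otimes>\<^bsub>Q\<^esub> comb q = comb (quat_mult a b p q)"
  by (cases p; cases q)
    (simp add: comb_eq l_distr r_distr scalar_distrib a_ac diff_conv_add_uminus mult_ac
      del: add_uminus_conv_diff)

lemma comb_zero: "\<zero>\<^bsub>Q\<^esub> = comb (0, 0, 0, 0)"
  and comb_scalar: "c \<odot>\<^bsub>Q\<^esub> \<one>\<^bsub>Q\<^esub> = comb (c, 0, 0, 0)"
  by (simp_all add: comb_eq)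

lemma comb_eq_iff: "comb p = comb q \<longleftrightarrow> p = q"
  using bij_comb by (simp add: bij_betw_def inj_eq)

lemma carrier_comb: "x \<in> carrier Q \<longleftrightarrow> (\<exists>p. x = comb p)"
  using bij_comb unfolding bij_betw_def by blast

lemma scalars_comb: "comb (w, x, y, z) \<in> quaternion_scalars Q \<longleftrightarrow> x = 0 \<and> y = 0 \<and> z = 0"
  by (auto simp: quaternion_scalars_def comb_scalar comb_eq_iff)

text \<open>The square of \<open>w + p\<close>, with \<open>p\<close> a combination of
  \<open>i\<close>, \<open>j\<close> and \<open>ij\<close>, has nonscalar part
  \<open>2 w p\<close>.\<close>

lemma pure_comb:
  assumes "(2::'a) \<noteq> 0"
  shows "comb (w, x, y, z) \<in> pure_quaternions Q \<longleftrightarrow> w = 0"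
proof -
  have "w * x + x * w = 2 * (w * x)" for x by simp
  then show ?thesis
    using assms
    by (auto simp: pure_quaternions_def comb_zero comb_eq_iff scalars_comb comb_mult)
qed

lemma conj_comb:
  assumes "(2::'a) \<noteq> 0"
  shows "quaternion_conj Q (comb (w, x, y, z)) = comb (w, - x, - y, - z)"
  unfolding quaternion_conj_def
proof (rule the_equality)
  show "\<exists>c. \<exists>p\<in>pure_quaternions Q. comb (w, x, y, z) = c \<odot>\<^bsub>Q\<^esub> \<one>\<^bsub>Q\<^esub> \<oplus>\<^bsub>Q\<^esub> p \<and>
      comb (w, - x, - y, - z) = c \<odot>\<^bsub>Q\<^esub> \<one>\<^bsub>Q\<^esub> \<ominus>\<^bsub>Q\<^esub> p"
    using pure_comb[OF assms, of 0 x y z]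
    by (intro exI[of _ w] bexI[of _ "comb (0, x, y, z)"])
      (simp_all add: comb_scalar comb_add comb_uminus a_minus_def)
next
  fix v
  assume "\<exists>c. \<exists>p\<in>pure_quaternions Q. comb (w, x, y, z) = c \<odot>\<^bsub>Q\<^esub> \<one>\<^bsub>Q\<^esub> \<oplus>\<^bsub>Q\<^esub> p \<and> v = c \<odot>\<^bsub>Q\<^esub> \<one>\<^bsub>Q\<^esub> \<ominus>\<^bsub>Q\<^esub> p"
  then obtain c p where p: "p \<in> pure_quaternions Q" "comb (w, x, y, z) = c \<odot>\<^bsub>Q\<^esub> \<one>\<^bsub>Q\<^esub> \<oplus>\<^bsub>Q\<^esub> p"
    "v = c \<odot>\<^bsub>Q\<^esub> \<one>\<^bsub>Q\<^esub> \<ominus>\<^bsub>Q\<^esub> p" by blast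
  then obtain w' x' y' z' where p': "p = comb (w', x', y', z')"
    by (auto simp: pure_quaternions_def carrier_comb)
  with p pure_comb[OF assms] show "v = comb (w, - x, - y, - z)"
    by (auto simp: comb_scalar comb_add comb_uminus a_minus_def comb_eq_iff)
qed

lemma norm_form_comb:
  assumes "(2::'a) \<noteq> 0"
  shows "norm_form Q (comb p) = quat_norm a b p"
proof (cases p)
  case (fields w x y z)
  then show ?thesis
    unfolding norm_form_def
    by (auto simp: conj_comb[OF assms] comb_mult comb_scalar comb_eq_iff intro!: the_equality)
qed

lemma isometric_pfister:
  assumes "(2::'a) \<noteq> 0"
  shows "isometric Q (norm_form Q) (coord_space 4)
    (diagonal_form (diag_tensor (pfister1 a) (pfister1 b)))"
proof -
  \<comment> \<open>\<open>diag_tensor\<close> lists the coefficients in the order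
    \<open>1, - b, - a, a b\<close>, hence the exchange of \<open>x\<close> and
    \<open>y\<close>.\<close>
  define g where "g = (\<lambda>(w, x, y, z). vec_of_list [w, y, x, z :: 'a])"
  define f where "f = g \<circ> inv_into UNIV comb"
  have inj: "inj comb" using bij_comb by (auto simp: bij_betw_def)
  have f: "f (comb p) = g p" for p by (simp add: f_def inj)
  have g: "bij_betw g UNIV (carrier_vec 4)"
  proof (rule bij_betw_byWitness[where f' = "\<lambda>v. (v $ 0, v $ 2, v $ 1, v $ 3)"])
    show "\<forall>v\<in>carrier_vec 4. g (v $ 0, v $ 2, v $ 1, v $ 3) = v"
      by (auto simp: g_def less_Suc_eq eval_nat_numeral intro!: eq_vecI)
  qed (auto simp: g_def numeral_2_eq_2 numeral_3_eq_3 intro!: carrier_vecI)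
  have "bij_betw f (carrier Q) (carrier_vec 4)"
    unfolding f_def using bij_comb g by (meson bij_betw_inv_into bij_betw_trans)
  moreover have "f \<in> LinearCombinations.module_hom class_ring Q (coord_space 4)"
    unfolding LinearCombinations.module_hom_def
    by (auto simp: carrier_comb comb_add comb_smult f module_vec_simps g_def class_ring_simps
        less_Suc_eq eval_nat_numeral intro!: eq_vecI carrier_vecI)
  moreover have "\<forall>x\<in>carrier Q. diagonal_form (diag_tensor (pfister1 a) (pfister1 b)) (f x) = norm_form Q x"
    by (auto simp: carrier_comb f norm_form_comb[OF assms] diagonal_form_def diag_tensor_def pfister1_def
        g_def eval_nat_numeral power2_eq_square algebra_simps)
  ultimately show ?thesis unfolding isometric_def by (auto simp: module_vec_simps)
qed

text \<open>Take \<open>P\<close> pure with square \<open>c\<close> and \<open>R\<close> pure,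
  orthogonal to \<open>P\<close>, with nonzero square \<open>d\<close>. They anticommute, and
  \<open>P\<close>, \<open>R\<close>, \<open>P R\<close> are orthogonal with squares
  \<open>c\<close>, \<open>d\<close>, \<open>- c d\<close>, all nonzero, so they form a basis of the
  pure part.\<close>

lemma change_generators:
  assumes two: "(2::'a) \<noteq> 0" and c: "pure_form a b p = c" "c \<noteq> 0"
  obtains d i' j' where "quaternion_generators Q c d i' j'"
proof -
  obtain x y z where p: "p = (x, y, z)" by (cases p)
  have "pure_form a b (x, y, z) \<noteq> 0" using c p by simp
  then obtain x' y' z' where orth: "a * x * x' + b * y * y' - a * b * z * z' = 0"
    and d: "pure_form a b (x', y', z') \<noteq> 0"
    using pure_form_orthogonal[OF two] gens(1,2) by metis
  define d where "d = pure_form a b (x', y', z')"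
  define P where "P = comb (0, x, y, z)"
  define R where "R = comb (0, x', y', z')"
  define x'' where "x'' = b * (z * y' - y * z')"
  define y'' where "y'' = a * (x * z' - z * x')"
  define z'' where "z'' = x * y' - y * x'"
  define L where "L = (\<lambda>(w :: 'a, u, v, t). (w, u * x + v * x' + t * x'', u * y + v * y' + t * y'', u * z + v * z' + t * z''))"
  define B where "B u1 u2 u3 v1 v2 v3 = a * u1 * v1 + b * u2 * v2 - a * b * u3 * v3" for u1 u2 u3 v1 v2 v3
  \<comment> \<open>\<open>M\<close> inverts the coordinate change \<open>L\<close> by orthogonal
    projection onto \<open>P\<close>, \<open>R\<close> and \<open>P R\<close>.\<close>
  define M where "M = (\<lambda>(w :: 'a, v1, v2, v3). (w, B v1 v2 v3 x y z / c, B v1 v2 v3 x' y' z' / d,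
    - B v1 v2 v3 x'' y'' z'' / (c * d)))"
  have cd: "c = a * x\<^sup>2 + b * y\<^sup>2 - a * b * z\<^sup>2" "d = a * x'\<^sup>2 + b * y'\<^sup>2 - a * b * z'\<^sup>2"
    using c p by (simp_all add: d_def)
  have "c \<noteq> 0" "d \<noteq> 0" using c d by (simp_all add: d_def)
  have PR: "P \<otimes>\<^bsub>Q\<^esub> R = comb (0, x'', y'', z'')"
    using orth by (simp add: P_def R_def comb_mult x''_def y''_def z''_def algebra_simps)
  have comb': "quaternion_comb Q P R p = comb (L p)" for p
  proof (cases p)
    case (fields w u v t)
    have "quaternion_comb Q P R p =
        w \<odot>\<^bsub>Q\<^esub> \<one>\<^bsub>Q\<^esub> \<oplus>\<^bsub>Q\<^esub> u \<odot>\<^bsub>Q\<^esub> P \<oplus>\<^bsub>Q\<^esub> v \<odot>\<^bsub>Q\<^esub> R \<oplus>\<^bsub>Q\<^esub> t \<odot>\<^bsub>Q\<^esub> comb (0, x'', y'', z'')"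
      by (simp only: fields quaternion_comb_def[of Q P R] prod.case PR)
    then show ?thesis
      by (simp add: fields P_def R_def comb_smult comb_scalar comb_add L_def)
  qed
  have 1: "B x y z x' y' z' = 0" "B x' y' z' x y z = 0" "B x'' y'' z'' x y z = 0" "B x'' y'' z'' x' y' z' = 0"
    "B x y z x'' y'' z'' = 0" "B x' y' z' x'' y'' z'' = 0"
    using orth by (simp_all add: B_def x''_def y''_def z''_def algebra_simps)
  have 2: "B x y z x y z = c" "B x' y' z' x' y' z' = d" by (simp_all add: B_def cd power2_eq_square)
  have 3: "B x'' y'' z'' x'' y'' z'' = - (c * d)"
  proof -
    have "B x'' y'' z'' x'' y'' z'' = - (c * d) + (a * x * x' + b * y * y' - a * b * z * z')\<^sup>2"
      unfolding B_def x''_def y''_def z''_def cd by (simp add: power2_eq_square algebra_simps)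
    then show ?thesis using orth by simp
  qed
  have lin: "B (u * u1 + v * v1 + t * t1) (u * u2 + v * v2 + t * t2) (u * u3 + v * v3 + t * t3) w1 w2 w3 =
    u * B u1 u2 u3 w1 w2 w3 + v * B v1 v2 v3 w1 w2 w3 + t * B t1 t2 t3 w1 w2 w3"
    for u v t u1 u2 u3 v1 v2 v3 t1 t2 t3 w1 w2 w3
    by (simp add: B_def algebra_simps)
  have inverse1: "M (L q) = q" for q
    by (cases q) (simp add: M_def L_def lin 1 2 3 \<open>c \<noteq> 0\<close> \<open>d \<noteq> 0\<close>)
  define g where "g = a * x * x' + b * y * y' - a * b * z * z'"
  \<comment> \<open>The expansion in the orthogonal basis with denominators cleared. Keeping the
    Gram entry \<open>g\<close> in place of its value 0 makes it a polynomial identity; the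
    coefficients come from the adjugate of the Gram matrix of \<open>P\<close> and
    \<open>R\<close>.\<close>
  define h where "h v1 v2 v3 l l' l'' = (d * B v1 v2 v3 x y z - g * B v1 v2 v3 x' y' z') * l
      + (c * B v1 v2 v3 x' y' z' - g * B v1 v2 v3 x y z) * l' - B v1 v2 v3 x'' y'' z'' * l''"
    for v1 v2 v3 l l' l''
  have h: "h v1 v2 v3 x x' x'' = v1 * (c * d - g\<^sup>2)" "h v1 v2 v3 y y' y'' = v2 * (c * d - g\<^sup>2)"
    "h v1 v2 v3 z z' z'' = v3 * (c * d - g\<^sup>2)" for v1 v2 v3
    unfolding h_def B_def x''_def y''_def z''_def cd g_def
    by (simp_all add: power2_eq_square algebra_simps)
  have "g = 0" using orth by (simp add: g_def)
  have inverse2: "L (M q) = q" for q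
  proof (cases q)
    case (fields w v1 v2 v3)
    have "B v1 v2 v3 x y z / c * l + B v1 v2 v3 x' y' z' / d * l'
        + - B v1 v2 v3 x'' y'' z'' / (c * d) * l'' = h v1 v2 v3 l l' l'' / (c * d)" for l l' l''
      using \<open>c \<noteq> 0\<close> \<open>d \<noteq> 0\<close> by (simp add: h_def \<open>g = 0\<close> field_simps)
    then show ?thesis
      using \<open>c \<noteq> 0\<close> \<open>d \<noteq> 0\<close> by (simp only: fields L_def M_def prod.case h \<open>g = 0\<close>) simp
  qed
  have "bij_betw L UNIV UNIV"
    by (rule bij_betw_byWitness[where f' = M]) (simp_all add: inverse1 inverse2)
  then have "bij_betw (comb \<circ> L) UNIV (carrier Q)"
    using bij_comb by (rule bij_betw_trans)
  also have "comb \<circ> L = quaternion_comb Q P R" by (simp add: fun_eq_iff comb')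
  finally have bij: "bij_betw (quaternion_comb Q P R) UNIV (carrier Q)" .
  have "R \<otimes>\<^bsub>Q\<^esub> P = \<ominus>\<^bsub>Q\<^esub> (P \<otimes>\<^bsub>Q\<^esub> R)"
    unfolding PR comb_uminus
    using orth by (simp add: P_def R_def comb_mult x''_def y''_def z''_def algebra_simps comb_eq_iff)
  moreover have "P \<otimes>\<^bsub>Q\<^esub> P = c \<odot>\<^bsub>Q\<^esub> \<one>\<^bsub>Q\<^esub>" "R \<otimes>\<^bsub>Q\<^esub> R = d \<odot>\<^bsub>Q\<^esub> \<one>\<^bsub>Q\<^esub>"
    by (simp_all add: P_def R_def comb_mult comb_scalar comb_eq_iff cd power2_eq_square algebra_simps)
  ultimately have "quaternion_generators Q c d P R"
    using \<open>c \<noteq> 0\<close> \<open>d \<noteq> 0\<close> bij by (simp add: quaternion_generators_def P_def R_def)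
  then show thesis by (rule that)
qed

end

section \<open>Torsion of the Witt group\<close>

lemma linear_functional_expand:
  fixes g :: "'a::comm_ring_1 vec \<Rightarrow> 'a"
  assumes add: "\<And>x y. \<lbrakk>x \<in> carrier_vec n; y \<in> carrier_vec n\<rbrakk> \<Longrightarrow> g (x + y) = g x + g y"
    and smult: "\<And>c x. x \<in> carrier_vec n \<Longrightarrow> g (c \<cdot>\<^sub>v x) = c * g x"
    and v: "v \<in> carrier_vec n"
  shows "g v = (\<Sum>i<n. v $ i * g (unit_vec n i))"
proof -
  have "g (vec n (\<lambda>i. if i < m then v $ i else 0)) = (\<Sum>i<m. v $ i * g (unit_vec n i))" if "m \<le> n" for m
    using that
  proof (induction m)
    case 0
    have "vec n (\<lambda>i. if i < 0 then v $ i else 0) = 0 \<cdot>\<^sub>v 0\<^sub>v n" by (intro eq_vecI) auto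
    then show ?case using smult[of "0\<^sub>v n" 0] by simp
  next
    case (Suc m)
    have "vec n (\<lambda>i. if i < Suc m then v $ i else 0) =
        vec n (\<lambda>i. if i < m then v $ i else 0) + v $ m \<cdot>\<^sub>v unit_vec n m"
      by (intro eq_vecI) (auto simp: less_Suc_eq unit_vec_def)
    with Suc show ?case by (simp add: add smult)
  qed
  from this[of n] have "g (vec n (\<lambda>i. if i < n then v $ i else 0)) = (\<Sum>i<n. v $ i * g (unit_vec n i))"
    by simp
  also have "vec n (\<lambda>i. if i < n then v $ i else 0) = v" using v by (intro eq_vecI) auto
  finally show ?thesis .
qed

text \<open>The matrix of \<open>f\<close> has trivial kernel, hence nonzero determinant and a
  two-sided inverse.\<close>

lemma linear_injective_imp_bij_betw:
  fixes f :: "'a::field vec \<Rightarrow> 'a vec"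
  assumes closed: "\<And>x. x \<in> carrier_vec n \<Longrightarrow> f x \<in> carrier_vec n"
    and add: "\<And>x y. \<lbrakk>x \<in> carrier_vec n; y \<in> carrier_vec n\<rbrakk> \<Longrightarrow> f (x + y) = f x + f y"
    and smult: "\<And>c x. x \<in> carrier_vec n \<Longrightarrow> f (c \<cdot>\<^sub>v x) = c \<cdot>\<^sub>v f x"
    and inj: "\<And>x. \<lbrakk>x \<in> carrier_vec n; f x = 0\<^sub>v n\<rbrakk> \<Longrightarrow> x = 0\<^sub>v n"
  shows "bij_betw f (carrier_vec n) (carrier_vec n)"
proof -
  define A where "A = mat n n (\<lambda>(r, c). f (unit_vec n c) $ r)"
  have A: "A \<in> carrier_mat n n" by (simp add: A_def)
  have fA: "f v = A *\<^sub>v v" if v: "v \<in> carrier_vec n" for v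
  proof (rule eq_vecI)
    fix r assume "r < dim_vec (A *\<^sub>v v)"
    then have r: "r < n" by (simp add: A_def)
    have "f v $ r = (\<Sum>i<n. v $ i * f (unit_vec n i) $ r)"
      by (rule linear_functional_expand[where g = "\<lambda>v. f v $ r", OF _ _ v])
        (use r closed in \<open>auto simp: add smult index_add_vec(1)[of r] index_smult_vec(1)[of r] carrier_vecD[OF closed]\<close>)
    also have "\<dots> = (A *\<^sub>v v) $ r"
      using r v by (auto simp: A_def scalar_prod_def atLeast0LessThan mult.commute intro!: sum.cong)
    finally show "f v $ r = (A *\<^sub>v v) $ r" .
  qed (use v closed[OF v] in \<open>auto simp: A_def\<close>)
  have "det A \<noteq> 0"
    using inj fA by (auto simp: det_0_iff_vec_prod_zero_field[OF A])
  then have "A \<in> Units (ring_mat TYPE('a) n ())" by (rule det_non_zero_imp_unit[OF A])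
  then obtain B where B: "B \<in> carrier_mat n n" "A * B = 1\<^sub>m n" "B * A = 1\<^sub>m n"
    by (auto simp: Units_def ring_mat_simps)
  show ?thesis
  proof (rule bij_betw_byWitness[where f' = "\<lambda>v. B *\<^sub>v v"])
    show "\<forall>v\<in>carrier_vec n. B *\<^sub>v f v = v"
      using B A by (auto simp: fA assoc_mult_mat_vec[symmetric, of B n n A n])
    show "\<forall>v\<in>carrier_vec n. f (B *\<^sub>v v) = v"
      using B A by (auto simp: fA assoc_mult_mat_vec[symmetric, of A n n B n])
  qed (use B A in \<open>auto simp: fA\<close>)
qed

section \<open>Similitudes of sums of squares\<close>

lemma sum_lessThan_add:
  fixes f :: "nat \<Rightarrow> 'a::comm_monoid_add"
  shows "(\<Sum>i<m + n. f i) = (\<Sum>i<m. f i) + (\<Sum>i<n. f (m + i))"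
  by (induction n) (simp_all add: add.assoc)

text \<open>Following Pfister, the inductive step completes a row \<open>(A\<^sub>1, A\<^sub>2)\<close> of similitudes to a block matrix; this
  needs the multiplier of \<open>A\<^sub>1\<close> to be nonzero, hence the case distinctions at the end.\<close>

lemma sum_of_squares_similitude:
  fixes x :: "nat \<Rightarrow> 'a::field"
  assumes "(\<Sum>i<2^r. (x i)\<^sup>2) = c"
  obtains A where "A \<in> carrier_mat (2^r) (2^r)"
    "A * A\<^sup>T = c \<cdot>\<^sub>m 1\<^sub>m (2^r)" "A\<^sup>T * A = c \<cdot>\<^sub>m 1\<^sub>m (2^r)"
  using assms
proof (induction r arbitrary: x c thesis)
  case 0
  let ?A = "mat 1 1 (\<lambda>_. x 0)"
  have "?A * ?A\<^sup>T = c \<cdot>\<^sub>m 1\<^sub>m (2^0)" "?A\<^sup>T * ?A = c \<cdot>\<^sub>m 1\<^sub>m (2^0)"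
    using 0 by (auto simp: scalar_prod_def power2_eq_square intro!: eq_matI)
  then show ?case using 0(1)[of ?A] by simp
next
  case (Suc r)
  let ?N = "2^r :: nat"
  define similitude where "similitude c \<longleftrightarrow> (\<exists>A\<in>carrier_mat (2^Suc r) (2^Suc r).
    A * A\<^sup>T = c \<cdot>\<^sub>m 1\<^sub>m (2^Suc r) \<and> A\<^sup>T * A = c \<cdot>\<^sub>m 1\<^sub>m (2^Suc r))" for c :: 'a
  have smult_smult_times: "a \<cdot>\<^sub>m (b \<cdot>\<^sub>m M) = (a * b) \<cdot>\<^sub>m M" for a b :: 'a and M
    by (rule eq_matI) (auto simp: mult.assoc)
  have one_smult: "1 \<cdot>\<^sub>m M = M" for M :: "'a mat"
    by (rule eq_matI) auto
  \<comment> \<open>For \<open>c\<close> nonzero, \<open>A\<^sup>T / c\<close> is a left inverse of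
    a square matrix and therefore a right inverse.\<close>
  have flip: "A * A\<^sup>T = c \<cdot>\<^sub>m 1\<^sub>m M"
    if A: "A \<in> carrier_mat M M" and AA: "A\<^sup>T * A = c \<cdot>\<^sub>m 1\<^sub>m M" and c: "c \<noteq> 0" for A M and c :: 'a
  proof -
    have AT: "A\<^sup>T \<in> carrier_mat M M" "(1 / c) \<cdot>\<^sub>m A\<^sup>T \<in> carrier_mat M M" using A by auto
    have "((1 / c) \<cdot>\<^sub>m A\<^sup>T) * A = 1\<^sub>m M"
      using c by (simp add: mult_smult_assoc_mat[OF AT(1) A] AA smult_smult_times one_smult)
    then have "A * ((1 / c) \<cdot>\<^sub>m A\<^sup>T) = 1\<^sub>m M"
      by (rule mat_mult_left_right_inverse[OF AT(2) A])
    then have "c \<cdot>\<^sub>m ((1 / c) \<cdot>\<^sub>m (A * A\<^sup>T)) = c \<cdot>\<^sub>m 1\<^sub>m M"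
      by (simp add: mult_smult_distrib[OF A AT(1)])
    then show ?thesis using c by (simp add: smult_smult_times one_smult)
  qed
  have step: "similitude (c1 + c2)"
    if A1: "A1 \<in> carrier_mat ?N ?N" "A1 * A1\<^sup>T = c1 \<cdot>\<^sub>m 1\<^sub>m ?N" "A1\<^sup>T * A1 = c1 \<cdot>\<^sub>m 1\<^sub>m ?N"
    and A2: "A2 \<in> carrier_mat ?N ?N" "A2 * A2\<^sup>T = c2 \<cdot>\<^sub>m 1\<^sub>m ?N" "A2\<^sup>T * A2 = c2 \<cdot>\<^sub>m 1\<^sub>m ?N"
    and c: "c1 \<noteq> 0" "c1 + c2 \<noteq> 0" for c1 c2 A1 A2
  proof -
    \<comment> \<open>Orthogonality of the two block columns of \<open>A\<close> reads
      \<open>X\<^sup>T A1\<^sup>T = A1\<^sup>T A2\<close>. Since \<open>A1 A1\<^sup>T = c1\<close>,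
      this forces \<open>X\<^sup>T = T / c1\<close>.\<close>
    define T where "T = A1\<^sup>T * (A2 * A1)"
    define X where "X = (1 / c1) \<cdot>\<^sub>m T\<^sup>T"
    define A where "A = four_block_mat A1 A2 X (- A1\<^sup>T)"
    have T: "T \<in> carrier_mat ?N ?N" "T\<^sup>T \<in> carrier_mat ?N ?N" using A1 A2 by (auto simp: T_def)
    have X: "X \<in> carrier_mat ?N ?N" using T by (simp add: X_def)
    have XT: "X\<^sup>T = (1 / c1) \<cdot>\<^sub>m T" by (rule eq_matI) (use T in \<open>auto simp: X_def\<close>)
    have TA: "T * A1\<^sup>T = c1 \<cdot>\<^sub>m (A1\<^sup>T * A2)"
    proof -
      have "T * A1\<^sup>T = A1\<^sup>T * (A2 * (A1 * A1\<^sup>T))"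
        using A1 A2 unfolding T_def by (simp add: assoc_mult_mat[of _ ?N ?N _ ?N _ ?N])
      also have "\<dots> = c1 \<cdot>\<^sub>m (A1\<^sup>T * A2)"
        using A1 A2 by (simp add: mult_smult_distrib[of _ ?N ?N _ ?N])
      finally show ?thesis .
    qed
    have TT: "T * T\<^sup>T = (c1 * c1 * c2) \<cdot>\<^sub>m 1\<^sub>m ?N"
    proof -
      have TTr: "T\<^sup>T = A1\<^sup>T * (A2\<^sup>T * A1)"
        unfolding T_def using A1 A2
        by (simp add: transpose_mult[of _ ?N ?N _ ?N] assoc_mult_mat[of _ ?N ?N _ ?N _ ?N])
      have "T * T\<^sup>T = (T * A1\<^sup>T) * (A2\<^sup>T * A1)"
        unfolding TTr using T A1 A2 by (simp add: assoc_mult_mat[of _ ?N ?N _ ?N _ ?N])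
      also have "\<dots> = c1 \<cdot>\<^sub>m (A1\<^sup>T * ((A2 * A2\<^sup>T) * A1))"
        unfolding TA using A1(1) A2(1)
        by (simp add: assoc_mult_mat[of _ ?N ?N _ ?N _ ?N] mult_smult_assoc_mat[of _ ?N ?N _ ?N])
      also have "(A2 * A2\<^sup>T) * A1 = c2 \<cdot>\<^sub>m A1"
        unfolding A2(2) using A1 by (simp add: mult_smult_assoc_mat[of _ ?N ?N _ ?N])
      also have "c1 \<cdot>\<^sub>m (A1\<^sup>T * (c2 \<cdot>\<^sub>m A1)) = (c1 * c1 * c2) \<cdot>\<^sub>m 1\<^sub>m ?N"
        using A1 by (simp add: mult_smult_distrib[of _ ?N ?N _ ?N] smult_smult_times one_smult ac_simps)
      finally show ?thesis .
    qed
    have XX: "X\<^sup>T * X = c2 \<cdot>\<^sub>m 1\<^sub>m ?N"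
    proof -
      have "X\<^sup>T * X = (1 / c1 * (1 / c1)) \<cdot>\<^sub>m (T * T\<^sup>T)"
        unfolding XT unfolding X_def using T
        by (simp add: mult_smult_distrib[of _ ?N ?N _ ?N] mult_smult_assoc_mat[of _ ?N ?N _ ?N] smult_smult_times one_smult)
      then show ?thesis unfolding TT using c by (simp add: smult_smult_times one_smult)
    qed
    have XA: "X\<^sup>T * A1\<^sup>T = A1\<^sup>T * A2"
      unfolding XT using T A1 c
      by (simp add: mult_smult_assoc_mat[of _ ?N ?N _ ?N] TA smult_smult_times one_smult)
    have AX: "A1 * X = A2\<^sup>T * A1"
    proof -
      have "(X\<^sup>T * A1\<^sup>T)\<^sup>T = (A1\<^sup>T * A2)\<^sup>T" by (simp add: XA)
      then show ?thesis using X A1 A2 by (simp add: transpose_mult[of _ ?N ?N _ ?N])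
    qed
    have A: "A \<in> carrier_mat (2^Suc r) (2^Suc r)"
      using A1 X by (auto simp: A_def mult_2)
    have At: "A\<^sup>T = four_block_mat A1\<^sup>T X\<^sup>T A2\<^sup>T (- A1\<^sup>T)\<^sup>T"
      unfolding A_def
      by (rule transpose_four_block_mat[of _ ?N ?N _ ?N _ ?N]) (use A1(1) A2(1) X in auto)
    have "A\<^sup>T * A = four_block_mat (A1\<^sup>T * A1 + X\<^sup>T * X) (A1\<^sup>T * A2 + X\<^sup>T * (- A1\<^sup>T))
        (A2\<^sup>T * A1 + (- A1\<^sup>T)\<^sup>T * X) (A2\<^sup>T * A2 + (- A1\<^sup>T)\<^sup>T * (- A1\<^sup>T))"
      unfolding At unfolding A_def
      by (rule mult_four_block_mat[of _ ?N ?N _ ?N _ ?N _ _ ?N _ ?N]) (use A1(1) A2(1) X in auto)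
    also have "\<dots> = four_block_mat ((c1 + c2) \<cdot>\<^sub>m 1\<^sub>m ?N) (0\<^sub>m ?N ?N) (0\<^sub>m ?N ?N) ((c1 + c2) \<cdot>\<^sub>m 1\<^sub>m ?N)"
    proof (rule cong_four_block_mat)
      show "A1\<^sup>T * A1 + X\<^sup>T * X = (c1 + c2) \<cdot>\<^sub>m 1\<^sub>m ?N"
        unfolding A1 XX by (rule eq_matI) auto
      show "A1\<^sup>T * A2 + X\<^sup>T * (- A1\<^sup>T) = 0\<^sub>m ?N ?N"
        using A1(1) A2(1) X by (auto simp: XA intro!: eq_matI)
      have "(- A1\<^sup>T)\<^sup>T = - A1" by (rule eq_matI) auto
      then show "A2\<^sup>T * A1 + (- A1\<^sup>T)\<^sup>T * X = 0\<^sub>m ?N ?N"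
        and "A2\<^sup>T * A2 + (- A1\<^sup>T)\<^sup>T * (- A1\<^sup>T) = (c1 + c2) \<cdot>\<^sub>m 1\<^sub>m ?N"
        using A1 A2 X by (auto simp: AX intro!: eq_matI)
    qed
    also have "\<dots> = (c1 + c2) \<cdot>\<^sub>m 1\<^sub>m (2^Suc r)"
      by (rule eq_matI) (auto simp: mult_2)
    finally have AA: "A\<^sup>T * A = (c1 + c2) \<cdot>\<^sub>m 1\<^sub>m (2^Suc r)" .
    have "A * A\<^sup>T = (c1 + c2) \<cdot>\<^sub>m 1\<^sub>m (2^Suc r)"
      using A AA c(2) by (rule flip)
    then show ?thesis using A AA by (auto simp: similitude_def)
  qed
  define c1 where "c1 = (\<Sum>i<?N. (x i)\<^sup>2)"
  define c2 where "c2 = (\<Sum>i<?N. (x (?N + i))\<^sup>2)"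
  have "c = c1 + c2"
    using Suc.prems(2) unfolding c1_def c2_def by (simp add: mult_2 sum_lessThan_add)
  obtain A1 where A1: "A1 \<in> carrier_mat ?N ?N" "A1 * A1\<^sup>T = c1 \<cdot>\<^sub>m 1\<^sub>m ?N" "A1\<^sup>T * A1 = c1 \<cdot>\<^sub>m 1\<^sub>m ?N"
    using Suc.IH[OF _ c1_def[symmetric]] by blast
  obtain A2 where A2: "A2 \<in> carrier_mat ?N ?N" "A2 * A2\<^sup>T = c2 \<cdot>\<^sub>m 1\<^sub>m ?N" "A2\<^sup>T * A2 = c2 \<cdot>\<^sub>m 1\<^sub>m ?N"
    using Suc.IH[OF _ c2_def[symmetric]] by blast
  have "similitude c"
  proof (cases "c = 0")
    case True
    have "0\<^sub>m (2^Suc r) (2^Suc r) * 0\<^sub>m (2^Suc r) (2^Suc r) = (0 :: 'a) \<cdot>\<^sub>m 1\<^sub>m (2^Suc r)"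
      by (rule eq_matI) auto
    then show ?thesis unfolding similitude_def True by (intro bexI[of _ "0\<^sub>m (2^Suc r) (2^Suc r)"]) auto
  next
    case False
    show ?thesis
    proof (cases "c1 = 0")
      case True
      then show ?thesis using step[OF A2 A1] \<open>c \<noteq> 0\<close> \<open>c = c1 + c2\<close> by (simp add: add.commute)
    next
      case False
      then show ?thesis using step[OF A1 A2] \<open>c \<noteq> 0\<close> \<open>c = c1 + c2\<close> by simp
    qed
  qed
  then show ?case using Suc.prems(1) by (auto simp: similitude_def)
qed

lemma sum_div_mod:
  fixes f :: "nat \<Rightarrow> nat \<Rightarrow> 'a::comm_monoid_add"
  shows "(\<Sum>p<N * n. f (p div n) (p mod n)) = (\<Sum>k<N. \<Sum>i<n. f k i)"
proof (induction N)
  case (Suc N)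
  have "(\<Sum>p<Suc N * n. f (p div n) (p mod n)) = (\<Sum>p<N * n + n. f (p div n) (p mod n))"
    by (simp add: add.commute)
  also have "\<dots> = (\<Sum>p<N * n. f (p div n) (p mod n)) + (\<Sum>i<n. f N i)"
    unfolding sum_lessThan_add by (intro arg_cong2[where f = "(+)"] sum.cong) auto
  finally show ?case using Suc.IH by simp
qed simp

lemma sum_rotate:
  "(\<Sum>a\<in>A. \<Sum>b\<in>B. \<Sum>c\<in>C. f a b c) = (\<Sum>b\<in>B. \<Sum>c\<in>C. \<Sum>a\<in>A. f a b c)"
  by (subst sum.swap) (intro sum.cong refl sum.swap)

section \<open>Polar forms and hyperbolicity of multiples\<close>

locale coord_quadratic_form =
  fixes n :: nat and q :: "'a::field vec \<Rightarrow> 'a"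
  assumes quadratic: "quadratic_form (coord_space n) q"
begin

definition polar :: "'a vec \<Rightarrow> 'a vec \<Rightarrow> 'a" where "polar x y = q (x + y) - q x - q y"

lemma polar_form_eq: "polar_form (coord_space n) q = polar"
  by (simp add: fun_eq_iff polar_form_def polar_def module_vec_simps)

lemma polar_add: "\<lbrakk>x \<in> carrier_vec n; y \<in> carrier_vec n; z \<in> carrier_vec n\<rbrakk> \<Longrightarrow> polar (x + y) z = polar x z + polar y z"
  and polar_smult: "\<lbrakk>x \<in> carrier_vec n; y \<in> carrier_vec n\<rbrakk> \<Longrightarrow> polar (c \<cdot>\<^sub>v x) y = c * polar x y"
  and form_smult: "x \<in> carrier_vec n \<Longrightarrow> q (c \<cdot>\<^sub>v x) = c\<^sup>2 * q x"
  using quadratic unfolding quadratic_form_def polar_form_eq module_vec_simps by blast+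

lemma polar_commute: "\<lbrakk>x \<in> carrier_vec n; y \<in> carrier_vec n\<rbrakk> \<Longrightarrow> polar x y = polar y x"
  unfolding polar_def by (subst comm_add_vec[of x n y]) simp_all

lemma polar_add_right: "\<lbrakk>x \<in> carrier_vec n; y \<in> carrier_vec n; z \<in> carrier_vec n\<rbrakk> \<Longrightarrow> polar z (x + y) = polar z x + polar z y"
  and polar_smult_right: "\<lbrakk>x \<in> carrier_vec n; y \<in> carrier_vec n\<rbrakk> \<Longrightarrow> polar x (c \<cdot>\<^sub>v y) = c * polar x y"
  by (metis polar_commute polar_add add_carrier_vec) (metis polar_commute polar_smult smult_carrier_vec)

lemma polar_self:
  assumes x: "x \<in> carrier_vec n"
  shows "polar x x = 2 * q x"
proof -
  have "x + x = 2 \<cdot>\<^sub>v x" by (rule eq_vecI) (use x in auto)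
  then have "q (x + x) = 2\<^sup>2 * q x" using x by (simp only: form_smult)
  then show ?thesis by (simp add: polar_def)
qed

text \<open>This is why the sum of \<open>q\<close> and \<open>- q\<close> is hyperbolic: its values
  are products of linear functions of \<open>x - y\<close> and of \<open>x + y\<close>.\<close>

lemma polar_diff_add:
  assumes "x \<in> carrier_vec n" "y \<in> carrier_vec n"
  shows "polar (x - y) (x + y) = 2 * (q x - q y)"
proof -
  have "x - y = x + (- 1) \<cdot>\<^sub>v y" by (rule eq_vecI) (use assms in auto)
  then have "polar (x - y) (x + y) = polar x x - polar y y"
    using assms by (simp add: polar_add polar_smult polar_add_right polar_commute[of y x])
  then show ?thesis using assms by (simp add: polar_self algebra_simps)
qed

lemma polar_expand_left:
  assumes "x \<in> carrier_vec n" "y \<in> carrier_vec n"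
  shows "polar x y = (\<Sum>i<n. x $ i * polar (unit_vec n i) y)"
  by (rule linear_functional_expand) (use assms in \<open>auto simp: polar_add polar_smult\<close>)

lemma polar_expand:
  assumes "x \<in> carrier_vec n" "y \<in> carrier_vec n"
  shows "polar x y = (\<Sum>i<n. \<Sum>j<n. polar (unit_vec n i) (unit_vec n j) * (x $ i * y $ j))"
proof -
  have "polar (unit_vec n i) y = (\<Sum>j<n. y $ j * polar (unit_vec n i) (unit_vec n j))" for i
    by (rule linear_functional_expand) (use assms in \<open>auto simp: polar_add_right polar_smult_right\<close>)
  then show ?thesis
    unfolding polar_expand_left[OF assms] by (simp add: sum_distrib_left ac_simps)
qed

text \<open>A matrix \<open>A\<close> with \<open>A A\<^sup>T = - 1\<close> is an isometry between \<open>N\<close> copies of \<open>q\<close> and \<open>N\<close> copies of \<open>- q\<close>.\<close>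

lemma sum_form_combination:
  fixes A :: "nat \<Rightarrow> nat \<Rightarrow> 'a"
  assumes two: "(2::'a) \<noteq> 0"
    and A: "\<And>k k'. \<lbrakk>k < N; k' < N\<rbrakk> \<Longrightarrow> (\<Sum>l<N. A k l * A k' l) = (if k = k' then - 1 else 0)"
  shows "(\<Sum>l<N. q (vec n (\<lambda>i. - (\<Sum>k<N. A k l * u k i)))) = - (\<Sum>k<N. q (vec n (u k)))"
proof -
  let ?G = "\<lambda>i j. polar (unit_vec n i) (unit_vec n j)"
  \<comment> \<open>After doubling, \<open>q\<close> is given by its Gram matrix, and the relation
    on \<open>A\<close> only has to be applied to products of coordinates.\<close>
  have two_q: "2 * q (vec n g) = (\<Sum>i<n. \<Sum>j<n. ?G i j * (g i * g j))" for g
    using polar_expand[of "vec n g" "vec n g"] polar_self[of "vec n g"] by simp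
  have inner: "(\<Sum>l<N. (- (\<Sum>k<N. A k l * u k i)) * (- (\<Sum>k<N. A k l * u k j))) = - (\<Sum>k<N. u k i * u k j)" for i j
  proof -
    have "(\<Sum>l<N. (- (\<Sum>k<N. A k l * u k i)) * (- (\<Sum>k<N. A k l * u k j))) =
        (\<Sum>l<N. \<Sum>k<N. \<Sum>k'<N. A k l * A k' l * (u k i * u k' j))"
      by (simp add: sum_product ac_simps)
    also have "\<dots> = (\<Sum>k<N. \<Sum>k'<N. \<Sum>l<N. A k l * A k' l * (u k i * u k' j))"
      by (rule sum_rotate)
    also have "\<dots> = (\<Sum>k<N. \<Sum>k'<N. (if k = k' then - 1 else 0) * (u k i * u k' j))"
      by (intro sum.cong refl) (simp add: sum_distrib_right[symmetric] A)
    also have "\<dots> = (\<Sum>k<N. - (u k i * u k j))"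
      by (intro sum.cong refl) (simp add: if_distrib[of "\<lambda>c. c * _"] cong: if_cong)
    finally show ?thesis by (simp add: sum_negf)
  qed
  have "2 * (\<Sum>l<N. q (vec n (\<lambda>i. - (\<Sum>k<N. A k l * u k i)))) =
      (\<Sum>l<N. \<Sum>i<n. \<Sum>j<n. ?G i j * ((- (\<Sum>k<N. A k l * u k i)) * (- (\<Sum>k<N. A k l * u k j))))"
    unfolding sum_distrib_left two_q ..
  also have "\<dots> = (\<Sum>i<n. \<Sum>j<n. \<Sum>l<N. ?G i j * ((- (\<Sum>k<N. A k l * u k i)) * (- (\<Sum>k<N. A k l * u k j))))"
    by (rule sum_rotate)
  also have "\<dots> = (\<Sum>i<n. \<Sum>j<n. ?G i j * - (\<Sum>k<N. u k i * u k j))"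
    by (simp only: sum_distrib_left[symmetric] inner)
  also have "\<dots> = - (\<Sum>i<n. \<Sum>j<n. \<Sum>k<N. ?G i j * (u k i * u k j))"
    by (simp add: sum_distrib_left sum_negf)
  also have "(\<Sum>i<n. \<Sum>j<n. \<Sum>k<N. ?G i j * (u k i * u k j)) = (\<Sum>k<N. \<Sum>i<n. \<Sum>j<n. ?G i j * (u k i * u k j))"
    by (rule sum_rotate[symmetric])
  also have "- \<dots> = 2 * - (\<Sum>k<N. q (vec n (u k)))"
    by (simp only: two_q[symmetric] sum_distrib_left[symmetric] mult_minus_right)
  finally show ?thesis by (rule mult_left_cancel[OF two, THEN iffD1])
qed

text \<open>With -1 a sum of \<open>N = 2 ^ r\<close> squares, a similitude with multiplier -1
  identifies \<open>N\<close> copies of \<open>q\<close> with \<open>N\<close> copies of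
  \<open>- q\<close>. So \<open>2 N\<close> copies of \<open>q\<close> form a hyperbolic space, and
  \<open>F\<close> is an explicit isometry.\<close>

lemma witt_finite_order:
  assumes two: "(2::'a) \<noteq> 0" and nonsing: "nonsingular (coord_space n) q" and nonreal: "nonreal TYPE('a)"
  shows "witt_finite_order n q"
proof -
  obtain xs :: "'a list" where xs: "- 1 = (\<Sum>x\<leftarrow>xs. x\<^sup>2)" using nonreal by (auto simp: nonreal_def)
  define r where "r = length xs"
  define N where "N = (2 :: nat) ^ r"
  \<comment> \<open>Padding with zeros brings the number of squares up to the power
    \<open>2 ^ r\<close>.\<close>
  define x where "x i = (if i < length xs then xs ! i else 0)" for i
  have "length xs \<le> N" by (simp add: N_def r_def less_imp_le)
  then have "(\<Sum>i<N. (x i)\<^sup>2) = (\<Sum>i<length xs. (xs ! i)\<^sup>2)"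
    by (intro sum.mono_neutral_cong_right) (auto simp: x_def)
  also have "\<dots> = - 1" by (simp add: xs sum_list_sum_nth atLeast0LessThan)
  finally have "(\<Sum>i<2 ^ r. (x i)\<^sup>2) = - 1" by (simp add: N_def)
  then obtain M :: "'a mat" where "M \<in> carrier_mat (2 ^ r) (2 ^ r)" "M * M\<^sup>T = (- 1) \<cdot>\<^sub>m 1\<^sub>m (2 ^ r)"
    by (rule sum_of_squares_similitude)
  then have M: "M \<in> carrier_mat N N" "M * M\<^sup>T = (- 1) \<cdot>\<^sub>m 1\<^sub>m N"
    by (simp_all only: N_def)
  define A where "A k l = M $$ (k, l)" for k l
  have A: "(\<Sum>l<N. A k l * A k' l) = (if k = k' then - 1 else 0)" if "k < N" "k' < N" for k k'
  proof -
    have "(\<Sum>l<N. A k l * A k' l) = (M * M\<^sup>T) $$ (k, k')"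
      using M(1) that by (simp add: A_def scalar_prod_def atLeast0LessThan)
    also have "\<dots> = (if k = k' then - 1 else 0)" using that by (simp add: M(2))
    finally show ?thesis .
  qed
  define L where "L = N * n"
  \<comment> \<open>\<open>X v k\<close> is the \<open>k\<close>-th block of \<open>v\<close>.
    \<open>Y v\<close> transforms the last \<open>N\<close> of the \<open>2 N\<close> blocks by
    \<open>A\<close>, which negates the sum of the values of \<open>q\<close>.\<close>
  define X where "X v k = vec n (\<lambda>i. v $ (k * n + i))" for v :: "'a vec" and k
  define Y where "Y v l = vec n (\<lambda>i. - (\<Sum>k<N. A k l * v $ ((N + k) * n + i)))" for v :: "'a vec" and l
  \<comment> \<open>Each of the \<open>N\<close> copies gives \<open>n\<close> hyperbolic planes:
    the \<open>i\<close>-th coordinate of \<open>X - Y\<close> is paired with half the polar product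
    of the \<open>i\<close>-th basis vector and \<open>X + Y\<close>. The products add up to half of
    \<open>polar (X - Y) (X + Y)\<close>, that is \<open>q X - q Y\<close>.\<close>
  define F where "F v = vec (2 * L) (\<lambda>t. let k = t div 2 div n; i = t div 2 mod n in
    if even t then (X v k - Y v k) $ i else polar (unit_vec n i) (X v k + Y v k) / 2)" for v
  have carrier [simp]: "X v k \<in> carrier_vec n" "Y v k \<in> carrier_vec n" for v k
    by (simp_all add: X_def Y_def)
  have index: "k * n + i < 2 * L" if "k < 2 * N" "i < n" for k i
  proof -
    have "k * n + i < (k + 1) * n" using that by simp
    also have "\<dots> \<le> (2 * N) * n" using that by (intro mult_right_mono) auto
    finally show ?thesis by (simp add: L_def)
  qed
  have XY_add: "X (v + w) k = X v k + X w k" "Y (v + w) k = Y v k + Y w k"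
    and XY_smult: "X (c \<cdot>\<^sub>v v) k = c \<cdot>\<^sub>v X v k" "Y (c \<cdot>\<^sub>v v) k = c \<cdot>\<^sub>v Y v k"
    if v: "v \<in> carrier_vec (2 * L)" and w: "w \<in> carrier_vec (2 * L)" and k: "k < N" for v w c k
  proof -
    have 1: "(v + w) $ (k * n + i) = v $ (k * n + i) + w $ (k * n + i)"
      "(c \<cdot>\<^sub>v v) $ (k * n + i) = c * v $ (k * n + i)" if "i < n" "k < 2 * N" for k i
      using v w index[OF that(2,1)] by auto
    have 2: "(v + w) $ ((N + l) * n + i) = v $ ((N + l) * n + i) + w $ ((N + l) * n + i)"
      "(c \<cdot>\<^sub>v v) $ ((N + l) * n + i) = c * v $ ((N + l) * n + i)" if "i < n" "l \<in> {..<N}" for l i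
      using 1[of i "N + l"] that by simp_all
    show "X (v + w) k = X v k + X w k" "X (c \<cdot>\<^sub>v v) k = c \<cdot>\<^sub>v X v k"
      using 1[of _ k] k by (auto simp: X_def intro!: eq_vecI)
    have "(\<Sum>l<N. A l k * (v + w) $ ((N + l) * n + i)) =
        (\<Sum>l<N. A l k * v $ ((N + l) * n + i)) + (\<Sum>l<N. A l k * w $ ((N + l) * n + i))"
      and "(\<Sum>l<N. A l k * (c \<cdot>\<^sub>v v) $ ((N + l) * n + i)) = c * (\<Sum>l<N. A l k * v $ ((N + l) * n + i))"
      if "i < n" for i
      unfolding sum.distrib[symmetric] sum_distrib_left
      by (intro sum.cong refl; simp only: 2[OF that]; simp add: algebra_simps)+
    then show "Y (v + w) k = Y v k + Y w k" "Y (c \<cdot>\<^sub>v v) k = c \<cdot>\<^sub>v Y v k"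
      by (auto simp: Y_def intro!: eq_vecI)
  qed
  have div_bound: "t div 2 div n < N" "t div 2 mod n < n" if "t < 2 * L" for t
  proof -
    have "t div 2 < N * n" using that by (auto simp: L_def)
    then show "t div 2 div n < N" "t div 2 mod n < n"
      by (auto simp: less_mult_imp_div_less intro!: mod_less_divisor gr0I)
  qed
  have F_closed: "F v \<in> carrier_vec (2 * L)" for v by (simp add: F_def)
  have F_add: "F (v + w) = F v + F w" and F_smult: "F (c \<cdot>\<^sub>v v) = c \<cdot>\<^sub>v F v"
    if v: "v \<in> carrier_vec (2 * L)" and w: "w \<in> carrier_vec (2 * L)" for v w c
  proof -
    show "F (v + w) = F v + F w"
    proof (rule eq_vecI)
      fix t assume "t < dim_vec (F v + F w)"
      then have t: "t < 2 * L" by (simp add: F_def)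
      have "X (v + w) k + Y (v + w) k = (X v k + Y v k) + (X w k + Y w k)"
        and "X (v + w) k - Y (v + w) k = (X v k - Y v k) + (X w k - Y w k)" if "k < N" for k
        using XY_add[OF v w that] by (auto simp: carrier_vecD[OF carrier(1)] carrier_vecD[OF carrier(2)] intro!: eq_vecI)
      then show "F (v + w) $ t = (F v + F w) $ t"
        using t div_bound[OF t]
        by (simp add: F_def Let_def polar_add_right add_divide_distrib
            carrier_vecD[OF carrier(1)] carrier_vecD[OF carrier(2)])
    qed (simp add: F_def)
    show "F (c \<cdot>\<^sub>v v) = c \<cdot>\<^sub>v F v"
    proof (rule eq_vecI)
      fix t assume "t < dim_vec (c \<cdot>\<^sub>v F v)"
      then have t: "t < 2 * L" by (simp add: F_def)
      have "X (c \<cdot>\<^sub>v v) k + Y (c \<cdot>\<^sub>v v) k = c \<cdot>\<^sub>v (X v k + Y v k)"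
        and "X (c \<cdot>\<^sub>v v) k - Y (c \<cdot>\<^sub>v v) k = c \<cdot>\<^sub>v (X v k - Y v k)" if "k < N" for k
        using XY_smult[OF v w that]
        by (auto simp: carrier_vecD[OF carrier(1)] carrier_vecD[OF carrier(2)] algebra_simps intro!: eq_vecI)
      then show "F (c \<cdot>\<^sub>v v) $ t = (c \<cdot>\<^sub>v F v) $ t"
        using t div_bound[OF t]
        by (simp add: F_def Let_def polar_smult_right
            carrier_vecD[OF carrier(1)] carrier_vecD[OF carrier(2)])
    qed (simp add: F_def)
  qed
  have F_inj: "v = 0\<^sub>v (2 * L)" if v: "v \<in> carrier_vec (2 * L)" and Fv: "F v = 0\<^sub>v (2 * L)" for v
  proof -
    have diff: "(X v k - Y v k) $ i = 0" and polar_zero: "polar (unit_vec n i) (X v k + Y v k) = 0"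
      if ki: "k < N" "i < n" for k i
    proof -
      have b: "k * n + i < L"
      proof -
        have "k * n + i < (k + 1) * n" using ki by simp
        also have "\<dots> \<le> N * n" using ki by (intro mult_right_mono) auto
        finally show ?thesis by (simp add: L_def)
      qed
      have "F v $ (2 * (k * n + i)) = 0" "F v $ (2 * (k * n + i) + 1) = 0"
        using b by (simp_all add: Fv)
      then show "(X v k - Y v k) $ i = 0" "polar (unit_vec n i) (X v k + Y v k) = 0"
        using b ki two by (simp_all add: F_def Let_def)
    qed
    \<comment> \<open>The even coordinates give \<open>X v k = Y v k\<close>. The odd ones put the
      sum into the radical, so it vanishes, and so do both vectors since 2 is invertible.\<close>
    have zero: "X v k = 0\<^sub>v n" "Y v k = 0\<^sub>v n" if k: "k < N" for k
    proof -
      have eq: "X v k = Y v k"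
        using diff[OF k] by (intro eq_vecI) (auto simp: carrier_vecD[OF carrier(1)] carrier_vecD[OF carrier(2)])
      have "polar (X v k + Y v k) y = 0" if "y \<in> carrier_vec n" for y
      proof -
        have "polar y (X v k + Y v k) = 0"
          using polar_zero[OF k] that polar_expand_left[of y "X v k + Y v k"] by simp
        then show ?thesis by (subst polar_commute) (use that in simp_all)
      qed
      then have "X v k + Y v k = 0\<^sub>v n"
        using nonsing by (auto simp: nonsingular_def polar_form_eq module_vec_simps)
      then have "(X v k + Y v k) $ i = 0" if "i < n" for i using that by simp
      then have "2 * X v k $ i = 0" if "i < n" for i
        using that eq by (simp add: carrier_vecD[OF carrier(1)] carrier_vecD[OF carrier(2)])
      then show "X v k = 0\<^sub>v n" using two by (intro eq_vecI) (auto simp: carrier_vecD[OF carrier(1)])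
      then show "Y v k = 0\<^sub>v n" by (simp add: eq)
    qed
    have first: "v $ (k * n + i) = 0" if "k < N" "i < n" for k i
    proof -
      have "X v k $ i = 0" using zero(1)[OF that(1)] that by simp
      then show ?thesis using that by (simp add: X_def)
    qed
    have second: "v $ ((N + k) * n + i) = 0" if k: "k < N" and i: "i < n" for k i
    proof -
      have Y0: "(\<Sum>k'<N. A k' l * v $ ((N + k') * n + i)) = 0" if "l < N" for l
      proof -
        have "Y v l $ i = 0" using zero(2)[OF that] i by simp
        then show ?thesis using i by (simp add: Y_def)
      qed
      \<comment> \<open>Multiplying by \<open>A\<close> once more undoes, up to sign, the passage
        from the last \<open>N\<close> blocks to \<open>Y v\<close>.\<close>
      have "(\<Sum>l<N. A k l * (\<Sum>k'<N. A k' l * v $ ((N + k') * n + i))) = 0"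
        by (simp add: Y0)
      also have "(\<Sum>l<N. A k l * (\<Sum>k'<N. A k' l * v $ ((N + k') * n + i))) =
          (\<Sum>k'<N. \<Sum>l<N. A k l * A k' l * v $ ((N + k') * n + i))"
        by (subst sum.swap) (simp add: sum_distrib_left mult.assoc)
      also have "\<dots> = (\<Sum>k'<N. (if k = k' then - 1 else 0) * v $ ((N + k') * n + i))"
        by (intro sum.cong refl) (use k in \<open>simp add: sum_distrib_right[symmetric] A\<close>)
      also have "\<dots> = - v $ ((N + k) * n + i)"
        using k by (simp add: if_distrib[of "\<lambda>c. c * _"] cong: if_cong)
      finally show ?thesis by simp
    qed
    show ?thesis
    proof (rule eq_vecI)
      fix t assume "t < dim_vec (0\<^sub>v (2 * L) :: 'a vec)"
      then have t: "t < (2 * N) * n" by (simp add: L_def)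
      then have i: "t mod n < n" by (auto intro!: mod_less_divisor gr0I)
      have d: "t div n < 2 * N" using t by (rule less_mult_imp_div_less)
      have "v $ (t div n * n + t mod n) = 0"
      proof (cases "t div n < N")
        case True
        then show ?thesis using first i by blast
      next
        case False
        then have "t div n = N + (t div n - N)" by simp
        then show ?thesis using second[of "t div n - N" "t mod n"] d i by simp
      qed
      then show "v $ t = 0\<^sub>v (2 * L) $ t" using t by (simp add: L_def)
    qed (use v in simp)
  qed
  have bij: "bij_betw F (carrier_vec (2 * L)) (carrier_vec (2 * L))"
    by (rule linear_injective_imp_bij_betw) (auto intro: F_closed F_add F_smult F_inj)
  have form: "hyperbolic_form L (F v) = form_multiple (2 * N) n q v" for v
  proof -
    have "hyperbolic_form L (F v) = (\<Sum>p<N * n. (X v (p div n) - Y v (p div n)) $ (p mod n) *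
        (polar (unit_vec n (p mod n)) (X v (p div n) + Y v (p div n)) / 2))"
      unfolding hyperbolic_form_def L_def by (intro sum.cong refl) (simp add: F_def L_def Let_def)
    also have "\<dots> = (\<Sum>k<N. \<Sum>i<n. (X v k - Y v k) $ i * (polar (unit_vec n i) (X v k + Y v k) / 2))"
      by (rule sum_div_mod)
    also have "\<dots> = (\<Sum>k<N. polar (X v k - Y v k) (X v k + Y v k) / 2)"
      by (intro sum.cong refl, subst polar_expand_left) (simp_all add: sum_divide_distrib)
    also have "\<dots> = (\<Sum>k<N. q (X v k) - q (Y v k))"
      using two by (intro sum.cong refl) (simp add: polar_diff_add)
    also have "\<dots> = (\<Sum>k<N. q (X v k)) - (\<Sum>l<N. q (Y v l))"
      by (rule sum_subtractf)
    also have "(\<Sum>l<N. q (Y v l)) = - (\<Sum>k<N. q (X v (N + k)))"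
      unfolding Y_def X_def by (rule sum_form_combination[OF two A])
    also have "(\<Sum>k<N. q (X v k)) - - (\<Sum>k<N. q (X v (N + k))) = form_multiple (2 * N) n q v"
      by (simp add: form_multiple_def X_def mult_2 sum_lessThan_add)
    finally show ?thesis .
  qed
  have last: "vec_last v (2 * L) = v" and first: "vec_first v (2 * L) = v"
    if "v \<in> carrier_vec (2 * L)" for v :: "'a vec"
    using that by (auto simp: vec_last_def vec_first_def intro!: eq_vecI)
  have L: "2 * N * n = 2 * L" by (simp add: L_def)
  \<comment> \<open>No hyperbolic plane is added to the multiple of \<open>q\<close>, and
    \<open>L\<close> planes are added to the zero form.\<close>
  have "isometric (coord_space (2 * N * n + 2 * 0))
      (orth_sum (2 * N * n) (form_multiple (2 * N) n q) (2 * 0) (hyperbolic_form 0))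
      (coord_space (0 + 2 * L)) (orth_sum 0 (\<lambda>_. 0) (2 * L) (hyperbolic_form L))"
    unfolding isometric_def L
  proof (intro exI[of _ F] conjI ballI)
    show "F \<in> LinearCombinations.module_hom class_ring (coord_space (2 * L + 2 * 0)) (coord_space (0 + 2 * L))"
      using F_closed F_add F_smult
      by (auto simp: LinearCombinations.module_hom_def module_vec_simps)
    show "bij_betw F (carrier (coord_space (2 * L + 2 * 0))) (carrier (coord_space (0 + 2 * L)))"
      using bij by (simp add: module_vec_simps)
    fix v :: "'a vec" assume "v \<in> carrier (coord_space (2 * L + 2 * 0))"
    then have v: "v \<in> carrier_vec (2 * L)" by (simp add: module_vec_simps)
    show "orth_sum 0 (\<lambda>_. 0) (2 * L) (hyperbolic_form L) (F v) =
        orth_sum (2 * L) (form_multiple (2 * N) n q) (2 * 0) (hyperbolic_form 0) v"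
      unfolding orth_sum_def last[OF F_closed] first[OF v] form by (simp add: hyperbolic_form_def)
  qed
  then show ?thesis
    unfolding witt_finite_order_def witt_equivalent_def
    by - (rule exI[of _ "2 * N"], rule conjI, simp add: N_def, rule exI[of _ 0], rule exI[of _ L])
qed

end

section \<open>Linkage\<close>

text \<open>A vector of the radical is isotropic, since its polar product with itself is twice its
  value.\<close>

lemma (in coord_quadratic_form) anisotropic_imp_nonsingular:
  assumes "(2::'a) \<noteq> 0" "anisotropic (coord_space n) q"
  shows "nonsingular (coord_space n) q"
  unfolding nonsingular_def polar_form_eq module_vec_simps
proof (intro ballI impI)
  fix x assume x: "x \<in> carrier_vec n" and "\<forall>y\<in>carrier_vec n. polar x y = 0"
  then have "q x = 0" using polar_self[OF x] assms(1) by simp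
  then show "x = 0\<^sub>v n" using assms(2) x by (simp add: anisotropic_def module_vec_simps)
qed

text \<open>An anisotropic form in five variables would be nonsingular and, over a nonreal field, of
  finite order, so it would enter the supremum.\<close>

lemma isotropic_dim5_of_u_invariant:
  assumes nonreal: "nonreal TYPE('a::field)" and char: "CHAR('a) \<noteq> 2" and u: "u_invariant TYPE('a) = 4"
  shows "isotropic_dim5 TYPE('a)"
proof
  show two: "(2::'a) \<noteq> 0"
  proof
    assume "(2::'a) = 0"
    then have "CHAR('a) dvd 2" by (metis of_nat_eq_0_iff_char_dvd of_nat_numeral)
    then have "CHAR('a) = 1 \<or> CHAR('a) = 2" by (metis prime_nat_iff two_is_prime_nat)
    moreover have "CHAR('a) \<noteq> 1" using of_nat_CHAR[where 'a = 'a] by (metis of_nat_1 zero_neq_one)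
    ultimately show False using char by simp
  qed
  fix q :: "'a vec \<Rightarrow> 'a" assume q: "quadratic_form (coord_space 5) q"
  interpret coord_quadratic_form 5 q by unfold_locales (rule q)
  show "\<not> anisotropic (coord_space 5) q"
  proof
    assume aniso: "anisotropic (coord_space 5) q"
    note nonsing = anisotropic_imp_nonsingular[OF two aniso]
    have "enat 5 \<le> u_invariant TYPE('a)"
      unfolding u_invariant_def
      using q nonsing aniso witt_finite_order[OF two nonsing nonreal] by (intro Sup_upper) blast
    then show False by (simp add: u numeral_eq_enat)
  qed
qed

lemma isometric_pfister_of_represents:
  assumes Q: "assoc_algebra class_ring Q" "quaternion_generators Q a b i j"
    and two: "(2::'a::field) \<noteq> 0" and c: "pure_form a b p = c" "c \<noteq> 0"
  shows "\<exists>d. d \<noteq> 0 \<and> isometric (Q :: ('a, 'q) module) (norm_form Q) (coord_space 4)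
    (diagonal_form (diag_tensor (pfister1 c) (pfister1 d)))"
proof -
  interpret quaternion_presentation Q a b i j
    using Q by (simp add: quaternion_presentation_def quaternion_presentation_axioms_def)
  obtain d i' j' where "quaternion_generators Q c d i' j'"
    by (rule change_generators[OF two c])
  then interpret new: quaternion_presentation Q c d i' j'
    using Q(1) by (simp add: quaternion_presentation_def quaternion_presentation_axioms_def)
  show ?thesis using new.gens(2) new.isometric_pfister[OF two] by blast
qed

theorem corollary5p3:
  fixes Q1 Q2 Q3 :: "('a::field, 'q) module"
  assumes "nonreal TYPE('a)"
    and "CHAR('a) \<noteq> 2"
    and "u_invariant TYPE('a) = 4"
    and "quaternion_algebra Q1" and "quaternion_algebra Q2" and "quaternion_algebra Q3"
  shows "linked {Q1, Q2, Q3}"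
proof -
  interpret isotropic_dim5 "TYPE('a)" by (rule isotropic_dim5_of_u_invariant[OF assms(1-3)])
  note alg = assms(4-6)[unfolded quaternion_algebra_def]
  obtain a1 b1 i1 j1 where "quaternion_generators Q1 a1 b1 i1 j1" using alg(1) by blast
  then interpret Q1: quaternion_presentation Q1 a1 b1 i1 j1
    using alg(1) by (simp add: quaternion_presentation_def quaternion_presentation_axioms_def)
  obtain a2 b2 i2 j2 where "quaternion_generators Q2 a2 b2 i2 j2" using alg(2) by blast
  then interpret Q2: quaternion_presentation Q2 a2 b2 i2 j2
    using alg(2) by (simp add: quaternion_presentation_def quaternion_presentation_axioms_def)
  obtain a3 b3 i3 j3 where "quaternion_generators Q3 a3 b3 i3 j3" using alg(3) by blast
  then interpret Q3: quaternion_presentation Q3 a3 b3 i3 j3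
    using alg(3) by (simp add: quaternion_presentation_def quaternion_presentation_axioms_def)
  \<comment> \<open>A common value of the pure parts becomes the common first slot \<open>m\<close>
    of \<open>Q1\<close> and \<open>Q2\<close>.\<close>
  obtain p q where pq: "pure_form a1 b1 p = pure_form a2 b2 q" and m: "pure_form a1 b1 p \<noteq> 0"
    by (rule pure_form_common_value[OF Q1.gens(1,2) Q2.gens(1,2)])
  define m where "m = pure_form a1 b1 p"
  obtain u1 k1 l1 where g1: "quaternion_generators Q1 m u1 k1 l1"
    by (rule Q1.change_generators[OF two, of p m]) (use m in \<open>simp_all add: m_def\<close>)
  obtain u2 k2 l2 where g2: "quaternion_generators Q2 m u2 k2 l2"
    by (rule Q2.change_generators[OF two, of q m]) (use m pq in \<open>simp_all add: m_def\<close>)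
  have nz: "m \<noteq> 0" "u1 \<noteq> 0" "u2 \<noteq> 0" "u1 * u2 \<noteq> 0"
    using g1 g2 by (auto simp: quaternion_generators_def)
  \<comment> \<open>\<open>(m, u1 u2)\<close> is the Brauer class of the product of
    \<open>Q1\<close> and \<open>Q2\<close>, so a common slot \<open>a\<close> of it and
    \<open>Q3\<close> makes \<open>Q1\<close> and \<open>Q2\<close> isomorphic over
    \<open>F(\<surd>a)\<close>.\<close>
  obtain r s where rs: "pure_form a3 b3 r = pure_form m (u1 * u2) s" and a: "pure_form a3 b3 r \<noteq> 0"
    by (rule pure_form_common_value[OF Q3.gens(1,2) nz(1,4)])
  define a where "a = pure_form a3 b3 r"
  obtain b k3 l3 where g3: "quaternion_generators Q3 a b k3 l3"
    by (rule Q3.change_generators[OF two, of r a]) (use a in \<open>simp_all add: a_def\<close>)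
  have ab: "a \<noteq> 0" "b \<noteq> 0" using g3 by (auto simp: quaternion_generators_def)
  obtain s0 w0 w1 where "s = (s0, w0, w1)" by (cases s)
  then have "a = pure_form m (u1 * u2) (s0, w0, w1)" using rs by (simp only: a_def)
  then obtain v1 v2 v3 where v: "pure_form m u1 v1 = pure_form a b v3" "pure_form m u2 v2 = pure_form a b v3"
    and c: "pure_form a b v3 \<noteq> 0"
    by (rule pure_form_common_value3_normalized[OF nz(1-3) ab])
  show ?thesis
    unfolding linked_def
    using isometric_pfister_of_represents[OF _ g1 two v(1) c] isometric_pfister_of_represents[OF _ g2 two v(2) c]
      isometric_pfister_of_represents[OF _ g3 two refl c] alg c
    by (intro exI[of _ "pure_form a b v3"]) blast
qed

end
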